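(* Let $n\ge 1$, let $b$ be a locally integrable function on $\mathbb{R}^n$ and let $0<\beta<1$. Suppose that $1<p<n/\beta$, $0<\lambda<n-\beta p$, $1/q=1/p-\beta/n$ and $\lambda/p=\mu/q$. Then $b\in\dot{\Lambda}_{\beta}(\mathbb{R}^n)$ if and only if the maximal commutator $M_b$ is bounded from $L^{p,\lambda}(\mathbb{R}^n)$ to $L^{q,\mu}(\mathbb{R}^n)$.
   Context: For a locally integrable function $b$ on $\mathbb{R}^n$, the maximal commutator is $$M_b(f)(x)=\sup_{Q\ni x}\frac{1}{|Q|}\int_Q |b(x)-b(y)|\,|f(y)|\,dy,$$ where the supremum is over all cubes $Q\subset\mathbb{R}^n$ containing $x$ (cubes have sides parallel to the coordinate axes) and $|E|$ denotes Lebesgue measure. "Bounded from $X$ to $Y$" means that there is a constant $C$ with $\|M_b(f)\|_Y\le C\|f\|_X$ for all $f\in X$. For $0<\beta<1$, a function $b$ belongs to the Lipschitz space $\dot{\Lambda}_{\beta}(\mathbb{R}^n)$ if there is a constant $C$ such that $|b(x)-b(y)|\le C|x-y|^{\beta}$ for all $x,y\in\mathbb{R}^n$. As usual, functions are identified if they agree almost everywhere, so for a locally integrable $b$, $b\in\dot{\Lambda}_{\beta}(\mathbb{R}^n)$ means that $b$ agrees a.e. with a function satisfying this condition. For $1\le p<\infty$ and $0\le\lambda\le n$, the Morrey space is $L^{p,\lambda}(\mathbb{R}^n)=\{f\in L^p_{\mathrm{loc}}(\mathbb{R}^n):\|f\|_{L^{p,\lambda}}<\infty\}$, where $$\|f\|_{L^{p,\lambda}}=\sup_Q\bigg(\frac{1}{|Q|^{\lambda/n}}\int_Q|f(x)|^p\,dx\bigg)^{1/p},$$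 the supremum being over all cubes $Q\subset\mathbb{R}^n$. *)

theory Defs
  imports "HOL-Analysis.Analysis"
begin

text \<open>The dimension is \<open>n = CARD('n)\<close>. Functions are everywhere-defined
  representatives of their almost-everywhere classes, measurable with respect to the completed
  Lebesgue measure.\<close>

definition cubes :: "(real ^ 'n) set set" where
  "cubes = {cbox a (\<chi> i. a $ i + l) | a l. 0 < l}"

definition locally_integrable :: "(real ^ 'n \<Rightarrow> real) \<Rightarrow> bool" where
  "locally_integrable b \<longleftrightarrow> (\<forall>K. compact K \<longrightarrow> b absolutely_integrable_on K)"

text \<open>Takes values in \<open>[0, \<infinity>]\<close>: for locally integrable \<open>b\<close> and \<open>f\<close> the product may fail
  to be locally integrable.\<close>

definition maximal_commutator ::
    "(real ^ 'n \<Rightarrow> real) \<Rightarrow> (real ^ 'n \<Rightarrow> real) \<Rightarrow> real ^ 'n \<Rightarrow> ennreal" where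
  "maximal_commutator b f x =
     (SUP Q \<in> {Q \<in> cubes. x \<in> Q}.
        (\<integral>\<^sup>+ y \<in> Q. ennreal (\<bar>b x - b y\<bar> * \<bar>f y\<bar>) \<partial>lebesgue) / emeasure lebesgue Q)"

definition lipschitz_space :: "real \<Rightarrow> (real ^ 'n \<Rightarrow> real) set" where
  "lipschitz_space \<beta> =
     {b. \<exists>g. (AE x in lebesgue. b x = g x) \<and>
             (\<exists>C. \<forall>x y. \<bar>g x - g y\<bar> \<le> C * norm (x - y) powr \<beta>)}"

text \<open>Real powers on \<open>[0, \<infinity>]\<close>; only used with exponent \<open>p > 0\<close>.\<close>

definition ennreal_powr :: "ennreal \<Rightarrow> real \<Rightarrow> ennreal" where
  "ennreal_powr x p = (if x = \<infinity> then \<infinity> else ennreal (enn2real x powr p))"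

text \<open>The norm is defined on \<open>[0, \<infinity>]\<close>-valued functions, so that it applies both to \<open>\<bar>f\<bar>\<close>
  and to maximal functions.\<close>

definition morrey_norm :: "real \<Rightarrow> real \<Rightarrow> (real ^ 'n \<Rightarrow> ennreal) \<Rightarrow> ennreal" where
  "morrey_norm p lam g =
     (SUP Q \<in> cubes.
        ennreal_powr
          ((\<integral>\<^sup>+ x \<in> Q. ennreal_powr (g x) p \<partial>lebesgue)
             / ennreal (measure lebesgue Q powr (lam / real CARD('n))))
          (1 / p))"

definition morrey_space :: "real \<Rightarrow> real \<Rightarrow> (real ^ 'n \<Rightarrow> real) set" where
  "morrey_space p lam =
     {f. f \<in> borel_measurable lebesgue \<and>
         (\<forall>K. compact K \<longrightarrow> (\<lambda>x. \<bar>f x\<bar> powr p) absolutely_integrable_on K) \<and>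
         morrey_norm p lam (\<lambda>x. ennreal \<bar>f x\<bar>) < \<infinity>}"

text \<open>The norm inequality makes the norm of the image finite, hence the image finite almost
  everywhere and in \<open>L\<^sup>q\<^sub>l\<^sub>o\<^sub>c\<close>; with measurability this is membership
  in the target space.\<close>

definition morrey_bounded ::
    "((real ^ 'n \<Rightarrow> real) \<Rightarrow> real ^ 'n \<Rightarrow> ennreal) \<Rightarrow> real \<Rightarrow> real \<Rightarrow> real \<Rightarrow> real \<Rightarrow> bool" where
  "morrey_bounded T p lam q mu \<longleftrightarrow>
     (\<exists>C::real. \<forall>f \<in> morrey_space p lam.
        T f \<in> borel_measurable lebesgue \<and>
        morrey_norm q mu (T f) \<le> ennreal C * morrey_norm p lam (\<lambda>x. ennreal \<bar>f x\<bar>))"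

end

theory Submission
  imports Defs
begin

text \<open>
  If \<open>b\<close> is Lipschitz of order \<open>\<beta>\<close>, the average of \<open>\<bar>b x - b y\<bar> * \<bar>f y\<bar>\<close> over a cube of
  side \<open>s\<close> is at most a constant times \<open>s powr \<beta>\<close> times the average of \<open>\<bar>f\<bar>\<close>. To bound the image
  on a cube of side \<open>l\<close>, cubes of side \<open>s < l\<close> only see \<open>f\<close> on the tripled cube, where Hedberg's
  inequality and the Hardy--Littlewood maximal theorem give the \<open>L\<^sup>p\<close> to \<open>L\<^sup>q\<close> bound, while for
  \<open>s \<ge> l\<close> the Morrey norm bounds the averages directly, because \<open>\<beta> + (\<lambda> - n) / p < 0\<close>.

  Conversely, testing on the indicator of a cube \<open>Q\<close> of side \<open>l\<close> bounds the mean oscillation of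
  \<open>b\<close> over \<open>Q\<close> by a constant times \<open>l powr \<beta>\<close>. The means over cubes with a fixed corner and
  shrinking side then converge to a Lipschitz function \<open>g\<close>, and the integral of \<open>\<bar>b - g\<bar>\<close> over a
  cube of side \<open>l\<close> is at most a constant times \<open>l powr \<beta>\<close> times its volume. Subdividing the cube
  shows that this integral vanishes.
\<close>

section \<open>Cubes and the maximal function\<close>

definition cube :: "real ^ 'n \<Rightarrow> real \<Rightarrow> (real ^ 'n) set" where
  "cube a l = cbox a (\<chi> i. a $ i + l)"

lemma mem_cube: "x \<in> cube a l \<longleftrightarrow> (\<forall>i. a $ i \<le> x $ i \<and> x $ i \<le> a $ i + l)"
  by (simp add: cube_def mem_box_cart)

lemma cubes_cube: "cubes = {cube a l | a l. 0 < l}"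
  by (simp add: cubes_def cube_def)

lemma cube_in_cubes: "0 < l \<Longrightarrow> cube a l \<in> cubes"
  by (auto simp: cubes_cube)

lemma cubesE:
  assumes "Q \<in> cubes" obtains a l where "Q = cube a l" "0 < l"
  using assms by (auto simp: cubes_cube)

lemma corner_in_cube: "0 \<le> l \<Longrightarrow> a \<in> cube a l"
  by (simp add: mem_cube)

lemma cube_subset:
  assumes "\<And>i. a' $ i \<le> a $ i" "\<And>i. a $ i + l \<le> a' $ i + l'"
  shows "cube a l \<subseteq> cube a' l'"
  using assms by (auto simp: mem_cube) (meson order_trans)+

lemma compact_cube: "compact (cube a l)"
  by (simp add: cube_def)

lemma sets_cube [measurable, simp]: "cube a l \<in> sets lebesgue"
  by (simp add: cube_def)

lemma measure_cube:
  fixes a :: "real ^ 'n"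
  assumes "0 \<le> l" shows "measure lebesgue (cube a l) = l ^ CARD('n)"
proof -
  have "measure lborel (cube a l) = (\<Prod>i\<in>(UNIV::'n set). l)"
    unfolding cube_def using assms by (subst content_cbox_cart) (auto simp: interval_ne_empty_cart)
  then show ?thesis by (simp add: cube_def)
qed

lemma emeasure_cube:
  fixes a :: "real ^ 'n"
  assumes "0 \<le> l" shows "emeasure lebesgue (cube a l) = ennreal (l ^ CARD('n))"
proof -
  have "emeasure lebesgue (cube a l) = ennreal (measure lebesgue (cube a l))"
    by (intro emeasure_eq_ennreal_measure) (simp add: cube_def emeasure_lborel_cbox_eq)
  then show ?thesis by (simp add: measure_cube assms)
qed

text \<open>As a simp rule it would rewrite \<open>emeasure lebesgue\<close> of a set to the
  \<open>lborel\<close> measure of its \<open>main_part\<close>, and \<open>emeasure_cube\<close>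
  would no longer match.\<close>

declare emeasure_completion [simp del]

text \<open>The passage through the l1 norm gives the factor n instead of its square root; later
  only the power of \<open>l\<close> matters.\<close>

lemma cube_diameter:
  fixes x y :: "real ^ 'n"
  assumes "x \<in> cube a l" "y \<in> cube a l"
  shows "norm (x - y) \<le> real CARD('n) * l"
proof -
  have "norm (x - y) \<le> (\<Sum>i\<in>UNIV. \<bar>(x - y) $ i\<bar>)" by (rule norm_le_l1_cart)
  also have "\<dots> \<le> (\<Sum>i\<in>(UNIV::'n set). l)"
  proof (rule sum_mono)
    fix i
    have "a $ i \<le> x $ i" "x $ i \<le> a $ i + l" "a $ i \<le> y $ i" "y $ i \<le> a $ i + l"
      using assms by (auto simp: mem_cube)
    then show "\<bar>(x - y) $ i\<bar> \<le> l" by simp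
  qed
  finally show ?thesis by simp
qed

text \<open>Greedy selection: keep a largest cube, discard those meeting it, and repeat.\<close>

lemma finite_vitali_cubes:
  fixes I :: "((real ^ 'n) \<times> real) set"
  assumes "finite I" "\<forall>j\<in>I. 0 < snd j"
  shows "\<exists>J\<subseteq>I. disjoint_family_on (\<lambda>(a, l). cube a l) J \<and>
           (\<Union>(a, l)\<in>I. cube a l) \<subseteq> (\<Union>(a, l)\<in>J. cube (\<chi> i. a $ i - l) (3 * l))"
  using assms
proof (induction "card I" arbitrary: I rule: less_induct)
  case less
  show ?case
  proof (cases "I = {}")
    case True then show ?thesis by (intro exI[of _ "{}"]) (auto simp: disjoint_family_on_def)
  next
    case False
    define L where "L = Max (snd ` I)"
    have "L \<in> snd ` I" unfolding L_def using False less.prems(1) by (intro Max_in) auto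
    then obtain a where aL: "(a, L) \<in> I" by auto
    have maxL: "l \<le> L" if "(c, l) \<in> I" for c l
      unfolding L_def using that less.prems(1) by (intro Max_ge) (auto simp: image_iff intro!: bexI[OF _ that])
    define I' where "I' = {(c, l) \<in> I. cube c l \<inter> cube a L = {}}"
    have Lpos: "0 < L" using less.prems(2) aL by fastforce
    have "a \<in> cube a L" using Lpos by (intro corner_in_cube) auto
    then have sub: "I' \<subset> I" using aL unfolding I'_def by blast
    have "card I' < card I" using sub less.prems(1) by (rule psubset_card_mono[rotated])
    moreover have "finite I'" using sub less.prems(1) finite_subset by blast
    moreover have "\<forall>j\<in>I'. 0 < snd j" using sub less.prems(2) by blast
    ultimately obtain J where J: "J \<subseteq> I'" "disjoint_family_on (\<lambda>(a, l). cube a l) J"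
      "(\<Union>(a, l)\<in>I'. cube a l) \<subseteq> (\<Union>(a, l)\<in>J. cube (\<chi> i. a $ i - l) (3 * l))"
      using less.hyps[of I'] by blast
    have dis: "disjoint_family_on (\<lambda>(a, l). cube a l) (insert (a, L) J)"
    proof -
      have "cube c l \<inter> cube a L = {}" if "(c, l) \<in> J" for c l
        using that J(1) unfolding I'_def by auto
      then show ?thesis using J(2) unfolding disjoint_family_on_def by fast
    qed
    \<comment> \<open>Since no side exceeds \<open>L\<close>, a cube meeting \<open>cube a L\<close>
      reaches at most \<open>L\<close> beyond it in each coordinate, so it stays in the concentric
      cube of side \<open>3 * L\<close>.\<close>
    have near: "cube c l \<subseteq> cube (\<chi> i. a $ i - L) (3 * L)"
      if cl: "(c, l) \<in> I" "cube c l \<inter> cube a L \<noteq> {}" for c l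
    proof (rule cube_subset)
      obtain z where z: "z \<in> cube c l" "z \<in> cube a L" using cl(2) by blast
      fix i
      have "c $ i \<le> z $ i" "z $ i \<le> c $ i + l" "a $ i \<le> z $ i" "z $ i \<le> a $ i + L"
        using z by (auto simp: mem_cube)
      moreover have "l \<le> L" using maxL cl(1) by blast
      ultimately show "(\<chi> i. a $ i - L) $ i \<le> c $ i" "c $ i + l \<le> (\<chi> i. a $ i - L) $ i + 3 * L"
        by simp_all
    qed
    have "(\<Union>(a, l)\<in>I. cube a l) \<subseteq> (\<Union>(a, l)\<in>insert (a, L) J. cube (\<chi> i. a $ i - l) (3 * l))"
    proof
      fix x assume "x \<in> (\<Union>(a, l)\<in>I. cube a l)"
      then obtain c l where cl: "(c, l) \<in> I" "x \<in> cube c l" by auto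
      show "x \<in> (\<Union>(a, l)\<in>insert (a, L) J. cube (\<chi> i. a $ i - l) (3 * l))"
      proof (cases "cube c l \<inter> cube a L = {}")
        case True
        then have "(c, l) \<in> I'" using cl by (auto simp: I'_def)
        then have "x \<in> (\<Union>(a, l)\<in>I'. cube a l)" using cl by blast
        then show ?thesis using J(3) by blast
      next
        case False then show ?thesis using near[OF cl(1)] cl(2) by blast
      qed
    qed
    then show ?thesis using dis J(1) sub aL by (intro exI[of _ "insert (a, L) J"]) blast
  qed
qed

text \<open>The uncentred Hardy--Littlewood maximal function. With nonnegative extended values
  allowed for \<open>h\<close>, the commutator at \<open>x\<close> is also of this form, with
  \<open>x\<close> frozen in the integrand.\<close>

definition maximal_function :: "(real ^ 'n \<Rightarrow> ennreal) \<Rightarrow> real ^ 'n \<Rightarrow> ennreal" where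
  "maximal_function h x =
     (SUP Q \<in> {Q \<in> cubes. x \<in> Q}. (\<integral>\<^sup>+ y \<in> Q. h y \<partial>lebesgue) / emeasure lebesgue Q)"

text \<open>A countable family that still computes the supremum. It gives measurability and lets
  level sets be exhausted by finite unions of cubes.\<close>

definition rat_cubes :: "(real ^ 'n) set set" where
  "rat_cubes = {Q \<in> cubes. \<exists>(f :: 'n \<Rightarrow> rat) (r :: rat). Q = cube (\<chi> i. of_rat (f i)) (of_rat r)}"

lemma countable_rat_cubes: "countable (rat_cubes :: (real ^ 'n) set set)"
proof -
  have "rat_cubes \<subseteq> range (\<lambda>(f :: 'n \<Rightarrow> rat, r :: rat). cube (\<chi> i. of_rat (f i)) (of_rat r))"
    by (auto simp: rat_cubes_def)
  then show ?thesis by (rule countable_subset) simp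
qed

text \<open>Each corner coordinate moves down by less than \<open>d\<close>, so every side above
  \<open>l + d\<close> still covers; the gap up to \<open>l + 2 * d\<close> leaves room for a
  rational side.\<close>

lemma rat_cube_enlarge:
  fixes a :: "real ^ 'n"
  assumes "0 < l" "0 < d"
  obtains c s where "cube c s \<in> rat_cubes" "cube a l \<subseteq> cube c s" "0 < s" "s \<le> l + 2 * d"
proof -
  have "\<exists>q::rat. a $ i - d < of_rat q \<and> of_rat q < a $ i" for i
    using of_rat_dense[of "a $ i - d" "a $ i"] assms by auto
  then obtain f :: "'n \<Rightarrow> rat" where f: "\<And>i. a $ i - d < of_rat (f i) \<and> of_rat (f i) < a $ i"
    by metis
  obtain r where r: "l + d < of_rat r" "of_rat r < l + 2 * d"
    using of_rat_dense[of "l + d" "l + 2 * d"] assms by auto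
  have rpos: "0 < real_of_rat r" using r assms by linarith
  show ?thesis
  proof
    show "cube (\<chi> i. of_rat (f i)) (of_rat r) \<in> (rat_cubes :: (real ^ 'n) set set)"
      using rpos by (auto simp: rat_cubes_def intro!: cube_in_cubes)
    show "cube a l \<subseteq> cube (\<chi> i. of_rat (f i)) (of_rat r)"
      using f r by (intro cube_subset) (auto simp: less_imp_le, smt (verit))
    show "0 < real_of_rat r" by (rule rpos)
    show "real_of_rat r \<le> l + 2 * d" using r by simp
  qed
qed

text \<open>Enlarging a cube to a rational one changes the average at most by the ratio of the
  volumes, which tends to 1 as the enlargement \<open>d\<close> tends to 0.\<close>

lemma maximal_function_rat:
  fixes h :: "real ^ 'n \<Rightarrow> ennreal"
  shows "maximal_function h x =
    (SUP Q \<in> {Q \<in> rat_cubes. x \<in> Q}. (\<integral>\<^sup>+ y \<in> Q. h y \<partial>lebesgue) / emeasure lebesgue Q)"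
    (is "_ = ?S")
proof (rule antisym)
  show "?S \<le> maximal_function h x"
    unfolding maximal_function_def by (rule SUP_subset_mono) (auto simp: rat_cubes_def)
  show "maximal_function h x \<le> ?S"
    unfolding maximal_function_def
  proof (rule SUP_least)
    fix Q :: "(real ^ 'n) set" assume "Q \<in> {Q \<in> cubes. x \<in> Q}"
    then obtain a l where Q: "Q = cube a l" "0 < l" "x \<in> cube a l" by (auto elim: cubesE)
    let ?I = "\<integral>\<^sup>+ y \<in> Q. h y \<partial>lebesgue"
    have bound: "?I \<le> ?S * ennreal ((l + 2 * d) ^ CARD('n))" if d: "0 < d" for d
    proof -
      obtain c s where cs: "cube c s \<in> rat_cubes" "cube a l \<subseteq> cube c s" "0 < s" "s \<le> l + 2 * d"
        using rat_cube_enlarge[OF Q(2) d] by metis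
      have pos: "ennreal (s ^ CARD('n)) \<noteq> 0" using cs by simp
      have "?I \<le> (\<integral>\<^sup>+ y \<in> cube c s. h y \<partial>lebesgue)"
        unfolding Q by (intro nn_integral_mono mult_left_mono) (use cs(2) in \<open>auto simp: indicator_def\<close>)
      also have "\<dots> = (\<integral>\<^sup>+ y \<in> cube c s. h y \<partial>lebesgue) / emeasure lebesgue (cube c s) * ennreal (s ^ CARD('n))"
        using cs pos by (simp add: emeasure_cube ennreal_divide_times)
      also have "\<dots> \<le> ?S * ennreal (s ^ CARD('n))"
        by (intro mult_right_mono SUP_upper) (use cs Q in auto)
      also have "\<dots> \<le> ?S * ennreal ((l + 2 * d) ^ CARD('n))"
        by (intro mult_left_mono ennreal_leI power_mono) (use cs in auto)
      finally show ?thesis .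
    qed
    have pos: "0 < l ^ CARD('n)" using Q by simp
    have "?I \<le> ?S * ennreal (l ^ CARD('n))"
    \<comment> \<open>The limit in \<open>d\<close> passes through a product, which is continuous in
      the other factor only when \<open>?S\<close> is finite.\<close>
    proof (cases "?S = top")
      case True show ?thesis unfolding True using Q(2) by (simp add: ennreal_top_mult)
    next
      case False
      have "((\<lambda>d. ?S * ennreal ((l + 2 * d) ^ CARD('n))) \<longlongrightarrow> ?S * ennreal ((l + 2 * 0) ^ CARD('n))) (at_right 0)"
        using False by (intro ennreal_tendsto_cmult tendsto_ennrealI tendsto_intros) (auto simp: top.not_eq_extremum)
      moreover have "\<forall>\<^sub>F d in at_right 0. ?I \<le> ?S * ennreal ((l + 2 * d) ^ CARD('n))"
        using eventually_at_right_less[of "0::real"] by eventually_elim (rule bound)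
      ultimately show ?thesis
        by (intro tendsto_lowerbound[of "\<lambda>d. ?S * ennreal ((l + 2 * d) ^ CARD('n))" _ "at_right (0::real)"]) auto
    qed
    then have "?I / ennreal (l ^ CARD('n)) \<le> ?S * ennreal (l ^ CARD('n)) / ennreal (l ^ CARD('n))"
      by (rule divide_right_mono_ennreal)
    also have "\<dots> = ?S" using pos Q(2) by (intro mult_divide_eq_ennreal) auto
    finally show "?I / emeasure lebesgue Q \<le> ?S"
      using Q by (simp add: emeasure_cube)
  qed
qed

section \<open>Measurability and the weak type inequality for the maximal function\<close>

lemma sigma_finite_completion:
  assumes "sigma_finite_measure M" shows "sigma_finite_measure (completion M)"
proof -
  obtain A where A: "countable A" "A \<subseteq> sets M" "\<Union>A = space M" "\<forall>a\<in>A. emeasure M a \<noteq> \<infinity>"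
    using sigma_finite_measure.sigma_finite_countable[OF assms] by blast
  then have "\<forall>a\<in>A. emeasure (completion M) a \<noteq> \<infinity>" "A \<subseteq> sets (completion M)"
    by (auto simp: subset_iff emeasure_completion)
  then show ?thesis using A by (auto intro!: sigma_finite_measure.intro exI[of _ A])
qed

interpretation lebesgue: sigma_finite_measure "lebesgue :: 'a::euclidean_space measure"
  by (rule sigma_finite_completion) (rule sigma_finite_lborel)

text \<open>Provides Tonelli's theorem for the layer-cake argument: heights \<open>t\<close> are
  integrated against \<open>lborel\<close>, points \<open>x\<close> against
  \<open>lebesgue\<close>.\<close>

interpretation lborel_lebesgue: pair_sigma_finite
  "lborel :: 'a::euclidean_space measure" "lebesgue :: 'b::euclidean_space measure" ..

text \<open>The index set depends on \<open>x\<close>. Multiplying by \<open>indicator Q x\<close>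
  replaces it by a fixed countable one, since additional values 0 do not change a supremum in
  \<open>ennreal\<close>.\<close>

lemma borel_measurable_SUP_rat_cubes:
  fixes F :: "(real ^ 'n) set \<Rightarrow> real ^ 'n \<Rightarrow> ennreal"
  assumes "\<And>Q. Q \<in> rat_cubes \<Longrightarrow> F Q \<in> borel_measurable lebesgue"
  shows "(\<lambda>x. SUP Q \<in> {Q \<in> rat_cubes. x \<in> Q}. F Q x) \<in> borel_measurable lebesgue"
proof -
  have "(SUP Q \<in> {Q \<in> rat_cubes. x \<in> Q}. F Q x) = (SUP Q \<in> rat_cubes. F Q x * indicator Q x)" for x
    by (rule antisym; rule SUP_least) (auto simp: indicator_def intro!: SUP_upper2)
  moreover have "(\<lambda>x. SUP Q \<in> rat_cubes. F Q x * indicator Q x) \<in> borel_measurable lebesgue"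
  proof (rule borel_measurable_SUP[OF countable_rat_cubes])
    fix Q :: "(real ^ 'n) set" assume Q: "Q \<in> rat_cubes"
    then have "Q \<in> sets lebesgue" by (auto simp: rat_cubes_def cubes_cube)
    then show "(\<lambda>x. F Q x * indicator Q x) \<in> borel_measurable lebesgue"
      using assms[OF Q] by measurable
  qed
  ultimately show ?thesis by simp
qed

lemma borel_measurable_maximal_function [measurable]:
  "maximal_function h \<in> borel_measurable lebesgue"
  unfolding maximal_function_rat by (rule borel_measurable_SUP_rat_cubes) simp

text \<open>The level set is the union of the rational cubes on which the average of
  \<open>h\<close> exceeds \<open>t\<close>. From finitely many of them the Vitali selection keeps
  disjoint ones whose triples cover, at the price \<open>3 ^ CARD('n)\<close>; the finite unions
  then increase to the whole level set.\<close>

lemma maximal_function_weak_type: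
  fixes h :: "real ^ 'n \<Rightarrow> ennreal"
  assumes [measurable]: "h \<in> borel_measurable lebesgue" and "0 < t"
  shows "ennreal t * emeasure lebesgue {x. ennreal t < maximal_function h x}
           \<le> ennreal (3 ^ CARD('n)) * (\<integral>\<^sup>+ x. h x \<partial>lebesgue)"
proof -
  define S where "S = {Q \<in> rat_cubes. ennreal t < (\<integral>\<^sup>+ y \<in> Q. h y \<partial>lebesgue) / emeasure lebesgue Q}"
  have level: "{x. ennreal t < maximal_function h x} = \<Union>S"
    unfolding maximal_function_rat S_def by (auto simp: less_SUP_iff)
  show ?thesis
  proof (cases "S = {}")
    case True then show ?thesis unfolding level by simp
  next
    case False
    have "countable S" unfolding S_def using countable_rat_cubes by (rule countable_subset[rotated]) auto
    then have ranS: "range (from_nat_into S) = S" using False by (simp add: range_from_nat_into)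
    have "\<exists>a l. from_nat_into S k = cube a l \<and> 0 < l" for k
    proof -
      have "from_nat_into S k \<in> S" using False by (rule from_nat_into)
      then show ?thesis by (auto simp: S_def rat_cubes_def cubes_cube)
    qed
    then obtain c s where cs: "\<And>k. from_nat_into S k = cube (c k) (s k)" "\<And>k. 0 < s k"
      by metis
    define U where "U N = (\<Union>k<N. cube (c k) (s k))" for N :: nat
    have bound: "ennreal t * emeasure lebesgue (U N) \<le> ennreal (3 ^ CARD('n)) * (\<integral>\<^sup>+ x. h x \<partial>lebesgue)"
      for N
    proof -
      \<comment> \<open>The enumeration repeats cubes when \<open>S\<close> is finite; passing to a
        set of pairs removes the repetitions before disjoint cubes are selected.\<close>
      let ?I = "(\<lambda>k. (c k, s k)) ` {..<N}"
      have fin: "finite ?I" by simp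
      have pos: "\<forall>j\<in>?I. 0 < snd j" using cs(2) by auto
      obtain J where J: "J \<subseteq> ?I" "disjoint_family_on (\<lambda>(a, l). cube a l) J"
          "(\<Union>(a, l)\<in>?I. cube a l) \<subseteq> (\<Union>(a, l)\<in>J. cube (\<chi> i. a $ i - l) (3 * l))"
        using finite_vitali_cubes[OF fin pos] by (elim exE conjE) (rule that)
      have finJ: "finite J" using J(1) finite_subset by blast
      have Jl: "0 < l \<and> ennreal t * ennreal (l ^ CARD('n)) \<le> (\<integral>\<^sup>+ y \<in> cube a l. h y \<partial>lebesgue)"
        if "(a, l) \<in> J" for a l
      proof -
        obtain k where k: "a = c k" "l = s k" using J(1) \<open>(a, l) \<in> J\<close> by auto
        have "cube (c k) (s k) \<in> S" using from_nat_into[OF False, of k] unfolding cs .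
        then have "ennreal t < (\<integral>\<^sup>+ y \<in> cube a l. h y \<partial>lebesgue) / ennreal (l ^ CARD('n))"
          using cs(2)[of k] unfolding S_def k by (simp add: emeasure_cube less_imp_le)
        then have "ennreal t * ennreal (l ^ CARD('n)) \<le>
            (\<integral>\<^sup>+ y \<in> cube a l. h y \<partial>lebesgue) / ennreal (l ^ CARD('n)) * ennreal (l ^ CARD('n))"
          by (intro mult_right_mono) auto
        also have "\<dots> = (\<integral>\<^sup>+ y \<in> cube a l. h y \<partial>lebesgue)"
          using cs(2)[of k] k by (simp add: ennreal_divide_times)
        finally show ?thesis using cs(2) k by simp
      qed
      have "U N \<subseteq> (\<Union>(a, l)\<in>J. cube (\<chi> i. a $ i - l) (3 * l))"
        using J(3) by (simp add: U_def)
      then have "emeasure lebesgue (U N) \<le> emeasure lebesgue (\<Union>(a, l)\<in>J. cube (\<chi> i. a $ i - l) (3 * l))"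
        by (intro emeasure_mono sets.finite_UN finJ) auto
      also have "\<dots> \<le> (\<Sum>j\<in>J. emeasure lebesgue (case j of (a, l) \<Rightarrow> cube (\<chi> i. a $ i - l) (3 * l)))"
        by (intro emeasure_subadditive_finite finJ) auto
      also have "\<dots> = (\<Sum>(a, l)\<in>J. ennreal (3 ^ CARD('n)) * ennreal (l ^ CARD('n)))"
        using Jl by (intro sum.cong) (auto simp: emeasure_cube power_mult_distrib less_imp_le ennreal_mult[symmetric])
      finally have "ennreal t * emeasure lebesgue (U N) \<le>
          ennreal t * (\<Sum>(a, l)\<in>J. ennreal (3 ^ CARD('n)) * ennreal (l ^ CARD('n)))"
        by (intro mult_left_mono) auto
      also have "\<dots> = ennreal (3 ^ CARD('n)) * (\<Sum>(a, l)\<in>J. ennreal t * ennreal (l ^ CARD('n)))"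
        by (simp add: sum_distrib_left split_def mult_ac)
      also have "\<dots> \<le> ennreal (3 ^ CARD('n)) * (\<Sum>(a, l)\<in>J. (\<integral>\<^sup>+ y \<in> cube a l. h y \<partial>lebesgue))"
        using Jl by (intro mult_left_mono sum_mono) auto
      also have "(\<Sum>(a, l)\<in>J. (\<integral>\<^sup>+ y \<in> cube a l. h y \<partial>lebesgue)) =
          (\<integral>\<^sup>+ y. (\<Sum>(a, l)\<in>J. h y * indicator (cube a l) y) \<partial>lebesgue)"
        unfolding split_def by (rule nn_integral_sum[symmetric]) measurable
      also have "\<dots> \<le> (\<integral>\<^sup>+ y. h y \<partial>lebesgue)"
      proof (rule nn_integral_mono)
        fix y
        have "(\<Sum>(a, l)\<in>J. h y * indicator (cube a l) y) = h y * (\<Sum>(a, l)\<in>J. indicator (cube a l) y)"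
          by (simp add: sum_distrib_left split_def)
        also have "(\<Sum>(a, l)\<in>J. indicator (cube a l) y) = (indicator (\<Union>(a, l)\<in>J. cube a l) y :: ennreal)"
          unfolding indicator_UN_disjoint[OF finJ J(2)] by (simp add: split_def)
        also have "h y * \<dots> \<le> h y" by (auto simp: indicator_def)
        finally show "(\<Sum>(a, l)\<in>J. h y * indicator (cube a l) y) \<le> h y" .
      qed
      finally show ?thesis by (simp add: mult_left_mono)
    qed
    have "\<Union>S = (\<Union>N. U N)"
    proof -
      have "(\<lambda>k. cube (c k) (s k)) = from_nat_into S" by (simp add: cs(1) fun_eq_iff)
      then have "range (\<lambda>k. cube (c k) (s k)) = S" by (simp only: ranS)
      then have "\<Union>S = (\<Union>k. cube (c k) (s k))" by (simp only:)
      also have "\<dots> = (\<Union>N. U N)" unfolding U_def by blast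
      finally show ?thesis .
    qed
    moreover have U_sets: "U N \<in> sets lebesgue" for N
      unfolding U_def by (intro sets.finite_UN) auto
    moreover have "incseq U" unfolding U_def incseq_def by (intro allI impI UN_mono) auto
    then have "emeasure lebesgue (\<Union>N. U N) = (SUP N. emeasure lebesgue (U N))"
      by (intro SUP_emeasure_incseq[symmetric]) (use U_sets in auto)
    ultimately have "ennreal t * emeasure lebesgue (\<Union>S) = (SUP N. ennreal t * emeasure lebesgue (U N))"
      by (simp add: SUP_mult_left_ennreal)
    also have "\<dots> \<le> ennreal (3 ^ CARD('n)) * (\<integral>\<^sup>+ x. h x \<partial>lebesgue)"
      by (intro SUP_least bound)
    finally show ?thesis unfolding level .
  qed
qed

text \<open>Pointwise \<open>h\<close> is at most \<open>s\<close> plus its part above height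
  \<open>s\<close>, and averaging preserves the constant \<open>s\<close>. Thus a level set of the
  maximal function is controlled by the large values of \<open>h\<close> alone.\<close>

lemma maximal_function_truncation:
  fixes h :: "real ^ 'n \<Rightarrow> ennreal"
  assumes [measurable]: "h \<in> borel_measurable lebesgue"
  shows "maximal_function h x \<le> maximal_function (\<lambda>y. h y * indicator {y. s < h y} y) x + s"
  unfolding maximal_function_def[of h]
proof (rule SUP_least)
  fix Q :: "(real ^ 'n) set" assume "Q \<in> {Q \<in> cubes. x \<in> Q}"
  then obtain a l where Q: "Q = cube a l" "0 < l" "x \<in> cube a l" by (auto elim: cubesE)
  let ?g = "\<lambda>y. h y * indicator {y. s < h y} y"
  have "(\<integral>\<^sup>+ y \<in> Q. h y \<partial>lebesgue) \<le> (\<integral>\<^sup>+ y. ?g y * indicator Q y + s * indicator Q y \<partial>lebesgue)"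
    by (intro nn_integral_mono) (auto simp: indicator_def)
  also have "\<dots> = (\<integral>\<^sup>+ y \<in> Q. ?g y \<partial>lebesgue) + s * emeasure lebesgue Q"
    unfolding Q by (subst nn_integral_add) (auto simp: nn_integral_cmult_indicator)
  finally have "(\<integral>\<^sup>+ y \<in> Q. h y \<partial>lebesgue) / emeasure lebesgue Q \<le>
      ((\<integral>\<^sup>+ y \<in> Q. ?g y \<partial>lebesgue) + s * emeasure lebesgue Q) / emeasure lebesgue Q"
    by (rule divide_right_mono_ennreal)
  also have "\<dots> = (\<integral>\<^sup>+ y \<in> Q. ?g y \<partial>lebesgue) / emeasure lebesgue Q + s"
    using Q by (simp add: add_divide_distrib_ennreal emeasure_cube mult_divide_eq_ennreal)
  also have "\<dots> \<le> maximal_function ?g x + s"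
    unfolding maximal_function_def using Q by (intro add_mono SUP_upper) (auto intro: cube_in_cubes)
  finally show "(\<integral>\<^sup>+ y \<in> Q. h y \<partial>lebesgue) / emeasure lebesgue Q \<le> maximal_function ?g x + s" .
qed

section \<open>The strong type inequality by layer-cake integration\<close>

lemma nn_integral_powr_Icc:
  assumes "0 < p" "0 \<le> r"
  shows "(\<integral>\<^sup>+ t. ennreal (t powr (p - 1)) * indicator {0..r} t \<partial>lborel) = ennreal (r powr p / p)"
  using nn_integral_has_integral_lebesgue'[OF _ has_integral_powr_from_0[of "p - 1" r]] assms
  by simp

text \<open>For each finite \<open>r\<close> up to \<open>u\<close>, the integral over
  \<open>{0..r}\<close> is \<open>r powr p\<close> and is dominated by the right side. When
  \<open>u\<close> is infinite, all these \<open>r\<close> together force the right side to be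
  infinite.\<close>

lemma layer_cake_le:
  assumes "0 < p"
  shows "ennreal_powr u p \<le>
    (\<integral>\<^sup>+ t. ennreal (p * t powr (p - 1)) * indicator {t. 0 \<le> t \<and> ennreal t < u} t \<partial>lborel)" (is "_ \<le> ?R")
proof -
  have le: "ennreal (r powr p) \<le> ?R" if r: "0 \<le> r" "ennreal r \<le> u" for r
  proof -
    have "ennreal (r powr p) = ennreal p * (\<integral>\<^sup>+ t. ennreal (t powr (p - 1)) * indicator {0..r} t \<partial>lborel)"
      using assms r by (simp add: nn_integral_powr_Icc ennreal_mult[symmetric])
    also have "\<dots> = (\<integral>\<^sup>+ t. ennreal (p * t powr (p - 1)) * indicator {0..r} t \<partial>lborel)"
      using assms by (subst nn_integral_cmult[symmetric]) (auto simp: ennreal_mult mult_ac)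
    also have "\<dots> \<le> ?R"
    proof (rule nn_integral_mono_AE)
      \<comment> \<open>At the endpoint \<open>t = r\<close> the strict inequality in the indicator
        fails if \<open>u = r\<close>; a single point is null.\<close>
      have "AE t in lborel. t \<noteq> r" by (rule AE_lborel_singleton)
      then show "AE t in lborel. ennreal (p * t powr (p - 1)) * indicator {0..r} t \<le>
          ennreal (p * t powr (p - 1)) * indicator {t. 0 \<le> t \<and> ennreal t < u} t"
      proof eventually_elim
        case (elim t)
        have "ennreal t < u" if "0 \<le> t" "t \<le> r"
          using that elim r by (intro less_le_trans[OF _ r(2)] ennreal_lessI) auto
        then show ?case by (auto simp: indicator_def)
      qed
    qed
    finally show ?thesis .
  qed
  show ?thesis
  proof (cases u)
    case (real r)
    then show ?thesis using le[of r] by (simp add: ennreal_powr_def)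
  next
    case top
    have *: "ennreal x \<le> ?R" if "0 \<le> x" for x
      using le[of "x powr (1 / p)"] that assms top by (simp add: powr_powr)
    have "?R = top"
    proof (cases ?R)
      case (real r)
      then have "ennreal (r + 1) \<le> ennreal r" using *[of "r + 1"] by simp
      then show ?thesis using real by simp
    qed
    then show ?thesis by simp
  qed
qed

text \<open>Marcinkiewicz interpolation. At height \<open>t\<close> the weak type bound is applied
  only to the part of \<open>h\<close> above \<open>t / 2\<close>. Integrating in \<open>t\<close>
  first leaves \<open>t powr (p - 2)\<close> over \<open>{0..2 * h x}\<close>, which converges at 0
  because \<open>1 < p\<close>.\<close>

theorem maximal_function_strong_type:
  fixes h :: "real ^ 'n \<Rightarrow> real"
  assumes [measurable]: "h \<in> borel_measurable lebesgue" and h0: "\<And>x. 0 \<le> h x" and p: "1 < p"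
  shows "(\<integral>\<^sup>+ x. ennreal_powr (maximal_function (\<lambda>y. ennreal (h y)) x) p \<partial>lebesgue)
    \<le> ennreal (3 ^ CARD('n) * 2 powr p * p / (p - 1)) * (\<integral>\<^sup>+ x. ennreal (h x powr p) \<partial>lebesgue)"
proof -
  let ?M = "maximal_function (\<lambda>y. ennreal (h y))"
  let ?k = "\<lambda>t. p * t powr (p - 1)"
  let ?c = "3 ^ CARD('n) :: real"
  have level: "ennreal (?k t) * emeasure lebesgue {x. ennreal t < ?M x} \<le>
      (\<integral>\<^sup>+ x. ennreal (2 * ?c * p * h x * t powr (p - 2)) * indicator {x. t < 2 * h x} x \<partial>lebesgue)"
    if t: "0 < t" for t
  proof -
    let ?g = "\<lambda>y. ennreal (h y) * indicator {y. ennreal (t / 2) < ennreal (h y)} y"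
    have "{x. ennreal t < ?M x} \<subseteq> {x. ennreal (t / 2) < maximal_function ?g x}"
    proof safe
      fix x assume x: "ennreal t < ?M x"
      show "ennreal (t / 2) < maximal_function ?g x"
      proof (rule ccontr)
        assume "\<not> ?thesis"
        then have "maximal_function ?g x + ennreal (t / 2) \<le> ennreal (t / 2) + ennreal (t / 2)"
          by (intro add_right_mono) simp
        also have "\<dots> = ennreal t" using t by (simp flip: ennreal_plus)
        finally show False
          using x maximal_function_truncation[of "\<lambda>y. ennreal (h y)" x "ennreal (t / 2)"] by simp
      qed
    qed
    moreover have "{x \<in> space lebesgue. ennreal (t / 2) < maximal_function ?g x} \<in> sets lebesgue"
      by measurable
    ultimately have "emeasure lebesgue {x. ennreal t < ?M x} \<le>
        emeasure lebesgue {x. ennreal (t / 2) < maximal_function ?g x}"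
      by (intro emeasure_mono) auto
    then have "ennreal (t / 2) * emeasure lebesgue {x. ennreal t < ?M x} \<le>
        ennreal (t / 2) * emeasure lebesgue {x. ennreal (t / 2) < maximal_function ?g x}"
      by (intro mult_left_mono) auto
    also have "\<dots> \<le> ennreal ?c * (\<integral>\<^sup>+ x. ?g x \<partial>lebesgue)"
      using t by (intro maximal_function_weak_type) auto
    finally have *: "ennreal (t / 2) * emeasure lebesgue {x. ennreal t < ?M x} \<le>
        ennreal ?c * (\<integral>\<^sup>+ x. ?g x \<partial>lebesgue)" .
    \<comment> \<open>Splits off the factor \<open>t / 2\<close> that stands on the left of the weak
      type inequality at height \<open>t / 2\<close>.\<close>
    have "?k t = 2 * p * t powr (p - 2) * (t / 2)"
      using t powr_add[of t "p - 2" 1] by simp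
    then have "ennreal (?k t) = ennreal (2 * p * t powr (p - 2)) * ennreal (t / 2)"
      using t p by (simp add: ennreal_mult[symmetric])
    then have "ennreal (?k t) * emeasure lebesgue {x. ennreal t < ?M x} \<le>
        ennreal (2 * p * t powr (p - 2)) * (ennreal ?c * (\<integral>\<^sup>+ x. ?g x \<partial>lebesgue))"
      using * by (simp add: mult.assoc mult_left_mono)
    also have "\<dots> = (\<integral>\<^sup>+ x. ennreal (2 * p * t powr (p - 2)) * (ennreal ?c * ?g x) \<partial>lebesgue)"
      by (simp add: nn_integral_cmult)
    also have "\<dots> = (\<integral>\<^sup>+ x. ennreal (2 * ?c * p * h x * t powr (p - 2)) * indicator {x. t < 2 * h x} x \<partial>lebesgue)"
      using t p h0 by (intro nn_integral_cong)
        (auto simp: indicator_def ennreal_less_iff ennreal_mult[symmetric] mult_ac)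
    finally show ?thesis .
  qed
  have "(\<integral>\<^sup>+ x. ennreal_powr (?M x) p \<partial>lebesgue) \<le>
      (\<integral>\<^sup>+ x. \<integral>\<^sup>+ t. ennreal (?k t) * indicator {t. 0 \<le> t \<and> ennreal t < ?M x} t \<partial>lborel \<partial>lebesgue)"
    using p by (intro nn_integral_mono layer_cake_le) auto
  also have "\<dots> = (\<integral>\<^sup>+ t. \<integral>\<^sup>+ x. ennreal (?k t) * indicator {t. 0 \<le> t \<and> ennreal t < ?M x} t \<partial>lebesgue \<partial>lborel)"
    by (rule lborel_lebesgue.Fubini') (unfold indicator_def, measurable)
  also have "\<dots> \<le> (\<integral>\<^sup>+ t. \<integral>\<^sup>+ x. ennreal (2 * ?c * p * h x * t powr (p - 2)) *
      indicator {t. 0 \<le> t \<and> t < 2 * h x} t \<partial>lebesgue \<partial>lborel)"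
  proof (rule nn_integral_mono_AE)
    have "AE t in lborel. t \<noteq> (0::real)" by (rule AE_lborel_singleton)
    then show "AE t in lborel.
        (\<integral>\<^sup>+ x. ennreal (?k t) * indicator {t. 0 \<le> t \<and> ennreal t < ?M x} t \<partial>lebesgue) \<le>
        (\<integral>\<^sup>+ x. ennreal (2 * ?c * p * h x * t powr (p - 2)) * indicator {t. 0 \<le> t \<and> t < 2 * h x} t \<partial>lebesgue)"
    proof eventually_elim
      case (elim t)
      show ?case
      proof (cases "0 < t")
        case True
        have "(\<integral>\<^sup>+ x. ennreal (?k t) * indicator {t. 0 \<le> t \<and> ennreal t < ?M x} t \<partial>lebesgue) =
            (\<integral>\<^sup>+ x. ennreal (?k t) * indicator {x. ennreal t < ?M x} x \<partial>lebesgue)"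
          using True by (intro nn_integral_cong) (auto simp: indicator_def)
        also have "\<dots> = ennreal (?k t) * emeasure lebesgue {x. ennreal t < ?M x}"
        proof (rule nn_integral_cmult_indicator)
          have "{x \<in> space lebesgue. ennreal t < ?M x} \<in> sets lebesgue" by measurable
          then show "{x. ennreal t < ?M x} \<in> sets lebesgue" by simp
        qed
        also note level[OF True]
        also have "(\<integral>\<^sup>+ x. ennreal (2 * ?c * p * h x * t powr (p - 2)) * indicator {x. t < 2 * h x} x \<partial>lebesgue) =
            (\<integral>\<^sup>+ x. ennreal (2 * ?c * p * h x * t powr (p - 2)) * indicator {t. 0 \<le> t \<and> t < 2 * h x} t \<partial>lebesgue)"
          using True by (intro nn_integral_cong) (auto simp: indicator_def)
        finally show ?thesis .
      next
        case False then show ?thesis using elim by simp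
      qed
    qed
  qed
  also have "\<dots> = (\<integral>\<^sup>+ x. \<integral>\<^sup>+ t. ennreal (2 * ?c * p * h x * t powr (p - 2)) *
      indicator {t. 0 \<le> t \<and> t < 2 * h x} t \<partial>lborel \<partial>lebesgue)"
    by (rule lborel_lebesgue.Fubini'[symmetric]) (unfold indicator_def, measurable)
  also have "\<dots> \<le> (\<integral>\<^sup>+ x. ennreal (?c * 2 powr p * p / (p - 1)) * ennreal (h x powr p) \<partial>lebesgue)"
  proof (rule nn_integral_mono)
    fix x
    have "(\<integral>\<^sup>+ t. ennreal (2 * ?c * p * h x * t powr (p - 2)) * indicator {t. 0 \<le> t \<and> t < 2 * h x} t \<partial>lborel) \<le>
       (\<integral>\<^sup>+ t. ennreal (2 * ?c * p * h x) * (ennreal (t powr ((p - 1) - 1)) * indicator {0..2 * h x} t) \<partial>lborel)"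
      using p h0[of x] by (intro nn_integral_mono) (auto simp: indicator_def ennreal_mult[symmetric])
    also have "\<dots> = ennreal (2 * ?c * p * h x) * ennreal ((2 * h x) powr (p - 1) / (p - 1))"
      using p h0[of x] by (subst nn_integral_cmult) (auto simp: nn_integral_powr_Icc[of "p - 1", simplified])
    also have "\<dots> = ennreal (?c * 2 powr p * p / (p - 1)) * ennreal (h x powr p)"
    proof -
      have e: "2 powr p = 2 * 2 powr (p - 1)" "h x powr p = h x * h x powr (p - 1)"
        using h0[of x] by (simp_all add: powr_mult_base)
      have "2 * ?c * p * h x * ((2 * h x) powr (p - 1) / (p - 1)) = ?c * 2 powr p * p / (p - 1) * h x powr p"
        unfolding e using h0[of x] by (simp add: powr_mult mult_ac)
      then show ?thesis using p h0[of x] by (simp add: ennreal_mult[symmetric])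
    qed
    finally show "(\<integral>\<^sup>+ t. ennreal (2 * ?c * p * h x * t powr (p - 2)) * indicator {t. 0 \<le> t \<and> t < 2 * h x} t \<partial>lborel) \<le>
       ennreal (?c * 2 powr p * p / (p - 1)) * ennreal (h x powr p)" .
  qed
  also have "\<dots> = ennreal (?c * 2 powr p * p / (p - 1)) * (\<integral>\<^sup>+ x. ennreal (h x powr p) \<partial>lebesgue)"
    by (rule nn_integral_cmult) measurable
  finally show ?thesis .
qed

section \<open>Morrey norms and the maximal commutator\<close>

lemma ennreal_powr_ennreal [simp]: "0 \<le> r \<Longrightarrow> ennreal_powr (ennreal r) p = ennreal (r powr p)"
  by (simp add: ennreal_powr_def)

lemma ennreal_powr_top [simp]: "ennreal_powr top p = top"
  by (simp add: ennreal_powr_def)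

lemma borel_measurable_ennreal_powr [measurable]: "(\<lambda>x. ennreal_powr x p) \<in> borel_measurable borel"
  unfolding ennreal_powr_def by measurable

text \<open>Moves a power to the other side of an inequality, so that roots and powers of suprema
  reduce to estimates for each cube.\<close>

lemma ennreal_powr_le_iff:
  assumes "0 < p" shows "ennreal_powr x p \<le> y \<longleftrightarrow> x \<le> ennreal_powr y (1 / p)"
proof (cases x; cases y)
  fix r s :: real assume *: "0 \<le> r" "x = ennreal r" "0 \<le> s" "y = ennreal s"
  have "r powr p \<le> s \<longleftrightarrow> r \<le> s powr (1 / p)"
    using powr_mono2[of "1 / p" "r powr p" s] powr_mono2[of p r "s powr (1 / p)"] assms *
    by (auto simp: powr_powr)
  then show ?thesis using * by simp
qed (use assms in \<open>auto simp: top_unique\<close>)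

lemma ennreal_powr_mono: "0 < p \<Longrightarrow> x \<le> y \<Longrightarrow> ennreal_powr x p \<le> ennreal_powr y p"
  by (subst ennreal_powr_le_iff) (auto simp: ennreal_powr_def powr_powr top_unique ennreal_enn2real_if split: if_splits)

lemma ennreal_divide_le_iff:
  assumes "0 < c" "0 \<le> d" shows "x / ennreal c \<le> ennreal d \<longleftrightarrow> x \<le> ennreal (d * c)"
proof
  assume "x / ennreal c \<le> ennreal d"
  then have "x / ennreal c * ennreal c \<le> ennreal d * ennreal c" by (rule mult_right_mono) simp
  then show "x \<le> ennreal (d * c)" using assms by (simp add: ennreal_divide_times ennreal_mult)
next
  assume "x \<le> ennreal (d * c)"
  then show "x / ennreal c \<le> ennreal d"
    using assms by (intro divide_le_posI_ennreal) (auto simp: ennreal_mult mult.commute)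
qed

lemma cube_volume_powr:
  "0 < l \<Longrightarrow> (l ^ CARD('n::finite)) powr (s / real CARD('n)) = l powr s"
  by (simp add: powr_realpow[symmetric] powr_powr)

text \<open>In terms of the side \<open>l\<close> the weight in the norm is
  \<open>l powr lam\<close>. Both directions of the theorem use Morrey norms through this
  form.\<close>

lemma morrey_norm_le_iff:
  fixes g :: "real ^ 'n \<Rightarrow> ennreal"
  assumes "0 < p" "0 \<le> N"
  shows "morrey_norm p lam g \<le> ennreal N \<longleftrightarrow>
    (\<forall>a l. 0 < l \<longrightarrow> (\<integral>\<^sup>+ x \<in> cube a l. ennreal_powr (g x) p \<partial>lebesgue) \<le> ennreal (N powr p * l powr lam))"
proof -
  have "ennreal_powr ((\<integral>\<^sup>+ x \<in> cube a l. ennreal_powr (g x) p \<partial>lebesgue) /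
      ennreal (measure lebesgue (cube a l) powr (lam / real CARD('n)))) (1 / p) \<le> ennreal N \<longleftrightarrow>
    (\<integral>\<^sup>+ x \<in> cube a l. ennreal_powr (g x) p \<partial>lebesgue) \<le> ennreal (N powr p * l powr lam)"
    if "0 < l" for a :: "real ^ 'n" and l
    using that assms ennreal_divide_le_iff[of "l powr lam" "N powr p"]
    by (simp add: ennreal_powr_le_iff measure_cube cube_volume_powr)
  then show ?thesis
    unfolding morrey_norm_def SUP_le_iff cubes_cube by blast
qed

lemma maximal_commutator_eq:
  "maximal_commutator b f x = maximal_function (\<lambda>y. ennreal (\<bar>b x - b y\<bar> * \<bar>f y\<bar>)) x"
  by (simp add: maximal_commutator_def maximal_function_def)

text \<open>With \<open>x\<close> frozen in the integrand the supremum reduces to rational cubes.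
  Each average is then measurable in \<open>x\<close> as a parameter integral over a sigma-finite
  measure.\<close>

lemma borel_measurable_maximal_commutator:
  fixes b f :: "real ^ 'n \<Rightarrow> real"
  assumes [measurable]: "b \<in> borel_measurable lebesgue" "f \<in> borel_measurable lebesgue"
  shows "maximal_commutator b f \<in> borel_measurable lebesgue"
  unfolding maximal_commutator_eq maximal_function_rat
proof (rule borel_measurable_SUP_rat_cubes)
  fix Q :: "(real ^ 'n) set" assume "Q \<in> rat_cubes"
  then have [measurable]: "Q \<in> sets lebesgue" by (auto simp: rat_cubes_def cubes_cube)
  show "(\<lambda>x. (\<integral>\<^sup>+ y \<in> Q. ennreal (\<bar>b x - b y\<bar> * \<bar>f y\<bar>) \<partial>lebesgue) / emeasure lebesgue Q)
      \<in> borel_measurable lebesgue"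
    by measurable
qed

text \<open>Jensen's inequality up to the factor 2, from
  \<open>F \<le> t + t powr (1 - q) * F powr q\<close> for \<open>t > 0\<close>.\<close>

lemma cube_integral_le_of_powr:
  fixes F :: "real ^ 'n \<Rightarrow> ennreal"
  assumes [measurable]: "F \<in> borel_measurable lebesgue" and "1 \<le> q" "0 \<le> t" "0 < l"
    and bound: "(\<integral>\<^sup>+ x \<in> cube a l. ennreal_powr (F x) q \<partial>lebesgue) \<le> ennreal (t powr q * l ^ CARD('n))"
  shows "(\<integral>\<^sup>+ x \<in> cube a l. F x \<partial>lebesgue) \<le> ennreal (2 * t * l ^ CARD('n))"
proof -
  \<comment> \<open>A positive \<open>s\<close> replaces \<open>t\<close>, because the pointwise
    inequality divides by \<open>s\<close>; the case \<open>t = 0\<close> follows by letting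
    \<open>s\<close> tend to 0.\<close>
  have *: "(\<integral>\<^sup>+ x \<in> cube a l. F x \<partial>lebesgue) \<le> ennreal (2 * s * l ^ CARD('n))" if s: "t \<le> s" "0 < s" for s
  proof -
    have pw: "F x \<le> ennreal s + ennreal (s powr (1 - q)) * ennreal_powr (F x) q" for x
    proof (cases "F x")
      case (real r)
      have "r \<le> s + s powr (1 - q) * r powr q"
      proof (cases "r \<le> s")
        case True
        then show ?thesis by (simp add: add_increasing2)
      next
        case False
        have "1 \<le> (r / s) powr (q - 1)" using False s \<open>1 \<le> q\<close> by (intro ge_one_powr_ge_zero) auto
        then have "r * 1 \<le> r * (r / s) powr (q - 1)" using real by (intro mult_left_mono) auto
        also have "\<dots> = r * r powr (q - 1) * s powr (1 - q)"
          using s real powr_minus[of s "q - 1"] by (simp add: powr_divide field_simps)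
        also have "r * r powr (q - 1) = r powr q" using real by (simp add: powr_mult_base)
        finally show ?thesis using s by (simp add: mult.commute)
      qed
      then show ?thesis using real s by (simp add: ennreal_mult[symmetric] flip: ennreal_plus)
    qed (use s in \<open>simp add: ennreal_mult_top\<close>)
    have "(\<integral>\<^sup>+ x \<in> cube a l. F x \<partial>lebesgue) \<le>
        (\<integral>\<^sup>+ x. ennreal s * indicator (cube a l) x +
          ennreal (s powr (1 - q)) * (ennreal_powr (F x) q * indicator (cube a l) x) \<partial>lebesgue)"
      using pw by (intro nn_integral_mono) (auto simp: indicator_def)
    also have "\<dots> = ennreal s * ennreal (l ^ CARD('n)) +
        ennreal (s powr (1 - q)) * (\<integral>\<^sup>+ x \<in> cube a l. ennreal_powr (F x) q \<partial>lebesgue)"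
      using \<open>0 < l\<close> by (simp add: nn_integral_add nn_integral_cmult nn_integral_cmult_indicator emeasure_cube)
    also have "\<dots> \<le> ennreal s * ennreal (l ^ CARD('n)) + ennreal (s powr (1 - q)) * ennreal (s powr q * l ^ CARD('n))"
    proof (intro add_left_mono mult_left_mono)
      have "t powr q \<le> s powr q" using s assms by (intro powr_mono2) auto
      then have "ennreal (t powr q * l ^ CARD('n)) \<le> ennreal (s powr q * l ^ CARD('n))"
        using \<open>0 < l\<close> by (intro ennreal_leI mult_right_mono) auto
      then show "(\<integral>\<^sup>+ x \<in> cube a l. ennreal_powr (F x) q \<partial>lebesgue) \<le> ennreal (s powr q * l ^ CARD('n))"
        using bound by (rule order_trans[rotated])
    qed simp
    also have "\<dots> = ennreal (s * l ^ CARD('n) + s powr (1 - q) * (s powr q * l ^ CARD('n)))"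
      using s \<open>0 < l\<close> by (simp add: ennreal_mult[symmetric] flip: ennreal_plus)
    also have "s powr (1 - q) * (s powr q * l ^ CARD('n)) = s * l ^ CARD('n)"
      using s powr_add[of s "1 - q" q] by simp
    finally show ?thesis by (simp add: algebra_simps)
  qed
  show ?thesis
  proof (cases "t = 0")
    case False then show ?thesis using * \<open>0 \<le> t\<close> by simp
  next
    case True
    have "(\<integral>\<^sup>+ x \<in> cube a l. F x \<partial>lebesgue) \<le> 0"
    proof (rule ennreal_le_epsilon)
      fix e :: real assume "0 < e"
      then show "(\<integral>\<^sup>+ x \<in> cube a l. F x \<partial>lebesgue) \<le> 0 + ennreal e"
        using *[of "e / (2 * l ^ CARD('n))"] True \<open>0 < l\<close> by simp
    qed
    then show ?thesis by simp
  qed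
qed

section \<open>Lipschitz functions have bounded commutators\<close>

text \<open>The scaling bookkeeping: the second relation makes the powers of the side cancel in
  Hedberg's argument, the third and fifth yield the exponent \<open>mu\<close> in the final bound,
  and the fourth makes averages over large cubes decay.\<close>

lemma exponent_relations:
  fixes n \<beta> p q lam mu :: real
  assumes "0 < n" "0 < \<beta>" "1 < p" "p < n / \<beta>" "0 < lam" "lam < n - \<beta> * p"
    and "1 / q = 1 / p - \<beta> / n" and "lam / p = mu / q"
  shows "p < q" "\<beta> * q = n / p * (q - p)" "(\<beta> + (lam - n) / p) * q + n = mu"
    "\<beta> + (lam - n) / p < 0" "lam / p * q = mu"
proof -
  have "\<beta> * p < n" using assms by (simp add: field_simps)
  have q: "1 / q = (n - \<beta> * p) / (p * n)" using assms by (simp add: field_simps)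
  then have "0 < 1 / q" using \<open>\<beta> * p < n\<close> assms by simp
  then have "0 < q" by simp
  have "p * n = q * (n - \<beta> * p)" using q assms \<open>0 < q\<close> \<open>\<beta> * p < n\<close> by (simp add: field_simps)
  then have rel: "\<beta> * p * q = n * (q - p)" by (simp add: algebra_simps)
  have "0 < \<beta> * p * q" using assms \<open>0 < q\<close> by simp
  then show "p < q" unfolding rel using assms by (simp add: zero_less_mult_iff)
  show 1: "\<beta> * q = n / p * (q - p)" using rel assms by (simp add: field_simps)
  show 2: "lam / p * q = mu" using assms \<open>0 < q\<close> by simp
  have "(\<beta> + (lam - n) / p) * q + n = \<beta> * q + lam / p * q - n / p * q + n"
    by (simp add: algebra_simps diff_divide_distrib)
  also have "\<dots> = mu" unfolding 1 2 using assms by (simp add: right_diff_distrib)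
  finally show "(\<beta> + (lam - n) / p) * q + n = mu" .
  show "\<beta> + (lam - n) / p < 0" using assms by (simp add: field_simps)
qed

text \<open>A cube \<open>Q \<ni> x\<close> with side \<open>s \<ge> l\<close> is estimated by the Morrey bound alone. A smaller one
  lies in the tripled cube, where Hedberg's interpolation between the maximal function and the
  \<open>L\<^sup>p\<close> norm of the localised function applies.\<close>

lemma commutator_pointwise_bound:
  fixes b f :: "real ^ 'n \<Rightarrow> real"
  defines "n \<equiv> real CARD('n)"
  assumes [measurable]: "b \<in> borel_measurable lebesgue" "f \<in> borel_measurable lebesgue"
    and x: "x \<in> cube a l" and l: "0 < l"
    and lip: "AE y in lebesgue. \<bar>b x - b y\<bar> \<le> C * norm (x - y) powr \<beta>" and C: "0 \<le> C"
    and N: "0 \<le> N"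
    and f: "\<And>a l. 0 < l \<Longrightarrow> (\<integral>\<^sup>+ y \<in> cube a l. ennreal (\<bar>f y\<bar> powr p) \<partial>lebesgue) \<le> ennreal (N powr p * l powr lam)"
    and exps: "0 < \<beta>" "1 < p" "p < q" "\<beta> * q = n / p * (q - p)" "\<beta> + (lam - n) / p < 0"
  shows "ennreal_powr (maximal_commutator b f x) q \<le>
    ennreal ((2 * (C * n powr \<beta>) * N * l powr (\<beta> + (lam - n) / p)) powr q) +
    ennreal ((C * n powr \<beta>) powr q * (2 * N * (3 * l) powr (lam / p)) powr (q - p)) *
      ennreal_powr (maximal_function (\<lambda>y. ennreal (\<bar>f y\<bar> * indicator (cube (\<chi> i. a $ i - l) (3 * l)) y)) x) p"
    (is "_ \<le> ?A + ?B * ennreal_powr ?M p")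
proof -
  define L where "L = C * n powr \<beta>"
  define W where "W = 2 * N * (3 * l) powr (lam / p)"
  have n: "0 < n" by (simp add: n_def)
  have L: "0 \<le> L" using C by (simp add: L_def)
  have W: "0 \<le> W" using N by (simp add: W_def)
  have q: "0 < q" using exps by simp
  have vol: "s ^ CARD('n) = s powr n" if "0 < s" for s
    using that by (simp add: n_def powr_realpow)
  \<comment> \<open>Moving the power \<open>q\<close> to the right leaves a bound on a supremum,
    which can be checked for each cube separately.\<close>
  have "maximal_commutator b f x \<le> ennreal_powr (?A + ?B * ennreal_powr ?M p) (1 / q)"
    unfolding maximal_commutator_def
  proof (rule SUP_least)
    fix Q :: "(real ^ 'n) set" assume "Q \<in> {Q \<in> cubes. x \<in> Q}"
    then obtain c s where Q: "Q = cube c s" and s: "0 < s" and xQ: "x \<in> cube c s" by (auto elim: cubesE)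
    let ?T = "(\<integral>\<^sup>+ y \<in> Q. ennreal (\<bar>b x - b y\<bar> * \<bar>f y\<bar>) \<partial>lebesgue) / emeasure lebesgue Q"
    define I where "I = (\<integral>\<^sup>+ y \<in> Q. ennreal \<bar>f y\<bar> \<partial>lebesgue)"
    have "(\<integral>\<^sup>+ y \<in> Q. ennreal (\<bar>b x - b y\<bar> * \<bar>f y\<bar>) \<partial>lebesgue) \<le>
        (\<integral>\<^sup>+ y. ennreal (L * s powr \<beta>) * (ennreal \<bar>f y\<bar> * indicator Q y) \<partial>lebesgue)"
    proof (rule nn_integral_mono_AE)
      show "AE y in lebesgue. ennreal (\<bar>b x - b y\<bar> * \<bar>f y\<bar>) * indicator Q y \<le>
          ennreal (L * s powr \<beta>) * (ennreal \<bar>f y\<bar> * indicator Q y)"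
        using lip
      proof eventually_elim
        case (elim y)
        show ?case
        proof (cases "y \<in> Q")
          case True
          have "norm (x - y) powr \<beta> \<le> (n * s) powr \<beta>"
            unfolding n_def using True exps(1) by (intro powr_mono2 cube_diameter[OF xQ]) (auto simp: Q)
          then have "\<bar>b x - b y\<bar> \<le> C * (n * s) powr \<beta>"
            using elim mult_left_mono[OF _ C] by (meson order_trans)
          also have "\<dots> = L * s powr \<beta>" using n s by (simp add: L_def powr_mult)
          finally have "\<bar>b x - b y\<bar> * \<bar>f y\<bar> \<le> L * s powr \<beta> * \<bar>f y\<bar>" by (rule mult_right_mono) simp
          then have "ennreal (\<bar>b x - b y\<bar> * \<bar>f y\<bar>) \<le> ennreal (L * s powr \<beta> * \<bar>f y\<bar>)" by (rule ennreal_leI)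
          then show ?thesis using True L by (simp add: ennreal_mult)
        qed simp
      qed
    qed
    also have "\<dots> = ennreal (L * s powr \<beta>) * I"
      unfolding I_def Q by (rule nn_integral_cmult) measurable
    finally have "?T \<le> ennreal (L * s powr \<beta>) * I / emeasure lebesgue Q"
      by (rule divide_right_mono_ennreal)
    then have T: "?T \<le> ennreal (L * s powr \<beta>) * (I / emeasure lebesgue Q)"
      by (simp add: ennreal_times_divide)
    \<comment> \<open>An \<open>L\<^sup>p\<close> norm of at most \<open>K\<close> on
      \<open>Q\<close> bounds the average there by \<open>K * s powr (- n / p)\<close>, up to the
      factor 2 of \<open>cube_integral_le_of_powr\<close>.\<close>
    have avg: "I / emeasure lebesgue Q \<le> ennreal (2 * K * s powr (- n / p))"
      if K: "0 \<le> K" "(\<integral>\<^sup>+ y \<in> Q. ennreal (\<bar>f y\<bar> powr p) \<partial>lebesgue) \<le> ennreal (K powr p)" for K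
    proof -
      have "I \<le> ennreal (2 * (K * s powr (- n / p)) * s ^ CARD('n))"
        unfolding I_def Q
      proof (rule cube_integral_le_of_powr)
        have "(K * s powr (- n / p)) powr p * s ^ CARD('n) = K powr p"
          using K s exps powr_add[of s "-n" n] by (simp add: powr_mult powr_powr vol)
        then show "(\<integral>\<^sup>+ y \<in> cube c s. ennreal_powr (ennreal \<bar>f y\<bar>) p \<partial>lebesgue)
            \<le> ennreal ((K * s powr (- n / p)) powr p * s ^ CARD('n))"
          using K by (simp add: Q)
      qed (use s K exps in auto)
      then show ?thesis
        using s K by (simp add: Q emeasure_cube ennreal_divide_le_iff mult.assoc)
    qed
    have "ennreal_powr ?T q \<le> ?A + ?B * ennreal_powr ?M p"
    proof (cases "l \<le> s")
      case True
      have "I / emeasure lebesgue Q \<le> ennreal (2 * (N * s powr (lam / p)) * s powr (- n / p))"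
        using f[OF s, of c] N exps by (intro avg) (auto simp: Q powr_mult powr_powr)
      then have "?T \<le> ennreal (L * s powr \<beta>) * ennreal (2 * (N * s powr (lam / p)) * s powr (- n / p))"
        by (intro order_trans[OF T] mult_left_mono) auto
      also have "\<dots> = ennreal (2 * L * N * (s powr \<beta> * (s powr (lam / p) * s powr (- n / p))))"
        using L N by (simp add: ennreal_mult[symmetric] mult_ac)
      also have "s powr \<beta> * (s powr (lam / p) * s powr (- n / p)) = s powr (\<beta> + (lam - n) / p)"
        by (simp add: powr_add[symmetric] diff_divide_distrib)
      finally have "?T \<le> ennreal (2 * L * N * s powr (\<beta> + (lam - n) / p))" .
      \<comment> \<open>The exponent is negative, so the side \<open>s\<close> may be replaced by
        the smaller \<open>l\<close>.\<close>
      also have "\<dots> \<le> ennreal (2 * L * N * l powr (\<beta> + (lam - n) / p))"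
        using True l L N exps by (intro ennreal_leI mult_left_mono powr_mono2') auto
      finally have "ennreal_powr ?T q \<le> ennreal_powr (ennreal (2 * L * N * l powr (\<beta> + (lam - n) / p))) q"
        using q by (intro ennreal_powr_mono)
      also have "\<dots> = ?A" using L N by (simp add: L_def)
      finally show ?thesis by (simp add: add_increasing2)
    next
      case False
      have sub: "Q \<subseteq> cube (\<chi> i. a $ i - l) (3 * l)"
        unfolding Q
      proof (rule cube_subset)
        fix i
        have "a $ i \<le> x $ i" "x $ i \<le> a $ i + l" "c $ i \<le> x $ i" "x $ i \<le> c $ i + s"
          using x xQ by (auto simp: mem_cube)
        then show "(\<chi> i. a $ i - l) $ i \<le> c $ i" "c $ i + s \<le> (\<chi> i. a $ i - l) $ i + 3 * l"
          using False by simp_all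
      qed
      have IM: "I / emeasure lebesgue Q \<le> ?M"
      proof -
        have "I = (\<integral>\<^sup>+ y \<in> Q. ennreal (\<bar>f y\<bar> * indicator (cube (\<chi> i. a $ i - l) (3 * l)) y) \<partial>lebesgue)"
          unfolding I_def using sub by (intro nn_integral_cong) (auto simp: indicator_def)
        then show ?thesis
          unfolding maximal_function_def using Q s xQ by (auto intro!: SUP_upper cube_in_cubes)
      qed
      have "(\<integral>\<^sup>+ y \<in> Q. ennreal (\<bar>f y\<bar> powr p) \<partial>lebesgue) \<le>
          (\<integral>\<^sup>+ y \<in> cube (\<chi> i. a $ i - l) (3 * l). ennreal (\<bar>f y\<bar> powr p) \<partial>lebesgue)"
        using sub by (intro nn_integral_mono) (auto simp: indicator_def)
      also have "\<dots> \<le> ennreal (N powr p * (3 * l) powr lam)" using l by (intro f) simp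
      also have "N powr p * (3 * l) powr lam = (N * (3 * l) powr (lam / p)) powr p"
        using N exps by (simp add: powr_mult powr_powr)
      finally have "I / emeasure lebesgue Q \<le> ennreal (2 * (N * (3 * l) powr (lam / p)) * s powr (- n / p))"
        using N by (intro avg) auto
      then have avgW: "I / emeasure lebesgue Q \<le> ennreal (W * s powr (- n / p))"
        by (simp add: W_def mult.assoc)
      then have "I / emeasure lebesgue Q < top" by (rule order_le_less_trans) simp
      then obtain \<alpha> where \<alpha>: "0 \<le> \<alpha>" "I / emeasure lebesgue Q = ennreal \<alpha>"
        by (cases "I / emeasure lebesgue Q") auto
      have \<alpha>W: "\<alpha> \<le> W * s powr (- n / p)" using avgW \<alpha> W by simp
      \<comment> \<open>Hedberg's split
        \<open>\<alpha> powr q = \<alpha> powr (q - p) * \<alpha> powr p\<close>: the first factor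
        absorbs \<open>s powr (\<beta> * q)\<close> because
        \<open>\<beta> * q = n / p * (q - p)\<close>, and the second is bounded by the maximal
        function.\<close>
      have "s powr (n / p) * \<alpha> \<le> s powr (n / p) * (W * s powr (- n / p))"
        using \<alpha>W by (intro mult_left_mono) auto
      also have "\<dots> = W" using s powr_add[of s "n / p" "- n / p"] by simp
      finally have "(s powr (n / p) * \<alpha>) powr (q - p) \<le> W powr (q - p)"
        using \<alpha> exps by (intro powr_mono2) auto
      then have hed: "s powr (\<beta> * q) * \<alpha> powr (q - p) \<le> W powr (q - p)"
        using \<alpha> exps by (simp add: powr_mult powr_powr)
      have "(L * s powr \<beta> * \<alpha>) powr q = L powr q * (s powr (\<beta> * q) * \<alpha> powr (q - p)) * \<alpha> powr p"
        using L \<alpha> powr_add[of \<alpha> "q - p" p] by (simp add: powr_mult powr_powr)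
      also have "\<dots> \<le> L powr q * W powr (q - p) * \<alpha> powr p"
        using hed by (intro mult_right_mono mult_left_mono) auto
      finally have h1: "ennreal ((L * s powr \<beta> * \<alpha>) powr q) \<le> ennreal (L powr q * W powr (q - p)) * ennreal (\<alpha> powr p)"
        by (simp add: ennreal_mult[symmetric])
      have h2: "ennreal (\<alpha> powr p) \<le> ennreal_powr ?M p"
        using ennreal_powr_mono[OF _ IM, of p] \<alpha> exps by simp
      have "?B = ennreal (L powr q * W powr (q - p))" by (simp add: L_def W_def)
      then have *: "ennreal ((L * s powr \<beta> * \<alpha>) powr q) \<le> ?B * ennreal_powr ?M p"
        using order_trans[OF h1 mult_left_mono[OF h2]] by simp
      have "?T \<le> ennreal (L * s powr \<beta> * \<alpha>)" using T L \<alpha> by (simp add: ennreal_mult)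
      then have "ennreal_powr ?T q \<le> ennreal ((L * s powr \<beta> * \<alpha>) powr q)"
        using ennreal_powr_mono[OF q] L \<alpha> by fastforce
      then show ?thesis by (intro add_increasing order_trans[OF _ *]) auto
    qed
    then show "?T \<le> ennreal_powr (?A + ?B * ennreal_powr ?M p) (1 / q)"
      using q by (simp add: ennreal_powr_le_iff)
  qed
  then show ?thesis using q by (simp add: ennreal_powr_le_iff)
qed

text \<open>The pointwise bound is integrated over a cube of side \<open>l\<close>, with the strong
  type inequality for the maximal term. By the exponent relations both terms are multiples of
  \<open>N powr q * l powr mu\<close>.\<close>

theorem lipschitz_imp_morrey_bounded:
  fixes b :: "real ^ 'n \<Rightarrow> real"
  defines "n \<equiv> real CARD('n)"
  assumes b [measurable]: "b \<in> borel_measurable lebesgue" and lip: "b \<in> lipschitz_space \<beta>"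
    and exps: "0 < \<beta>" "1 < p" "p < n / \<beta>" "0 < lam" "lam < n - \<beta> * p"
      "1 / q = 1 / p - \<beta> / n" "lam / p = mu / q"
  shows "morrey_bounded (maximal_commutator b) p lam q mu"
proof -
  have n: "0 < n" by (simp add: n_def)
  note rel = exponent_relations[OF n exps]
  have q: "0 < q" using rel(1) exps by simp
  obtain g C0 where bg: "AE x in lebesgue. b x = g x"
    and g: "\<And>x y. \<bar>g x - g y\<bar> \<le> C0 * norm (x - y) powr \<beta>"
    using lip unfolding lipschitz_space_def by blast
  define C where "C = \<bar>C0\<bar>"
  have C: "0 \<le> C" by (simp add: C_def)
  have gC: "\<bar>g x - g y\<bar> \<le> C * norm (x - y) powr \<beta>" for x y
    unfolding C_def by (rule order_trans[OF g mult_right_mono]) auto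
  define L where "L = C * n powr \<beta>"
  define H where "H = 3 ^ CARD('n) * 2 powr p * p / (p - 1)"
  \<comment> \<open>The first summand comes from cubes of side at least \<open>l\<close>, the second
    from smaller ones; \<open>H\<close> is the strong type constant and \<open>3 powr mu\<close> is
    due to tripling the cube.\<close>
  define K where "K = (2 * L) powr q + L powr q * 2 powr (q - p) * H * 3 powr mu"
  have L: "0 \<le> L" using C by (simp add: L_def)
  have H: "0 \<le> H" using exps by (simp add: H_def)
  have K: "0 \<le> K" using H by (simp add: K_def)
  have main: "(\<integral>\<^sup>+ x \<in> cube a l. ennreal_powr (maximal_commutator b f x) q \<partial>lebesgue)
      \<le> ennreal ((K powr (1 / q) * N) powr q * l powr mu)"
    if fm [measurable]: "f \<in> borel_measurable lebesgue" and N: "0 \<le> N" and l: "0 < l"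
      and f: "\<And>a l. 0 < l \<Longrightarrow> (\<integral>\<^sup>+ y \<in> cube a l. ennreal (\<bar>f y\<bar> powr p) \<partial>lebesgue) \<le> ennreal (N powr p * l powr lam)"
    for f N a l
  proof -
    let ?f1 = "\<lambda>y. \<bar>f y\<bar> * indicator (cube (\<chi> i. a $ i - l) (3 * l)) y"
    define A where "A = (2 * L * N * l powr (\<beta> + (lam - n) / p)) powr q"
    define B where "B = L powr q * (2 * N * (3 * l) powr (lam / p)) powr (q - p)"
    have [measurable]: "?f1 \<in> borel_measurable lebesgue" by measurable
    have B: "0 \<le> B" by (simp add: B_def)
    have "(\<integral>\<^sup>+ x. ennreal_powr (maximal_function (\<lambda>y. ennreal (?f1 y)) x) p \<partial>lebesgue)
        \<le> ennreal H * (\<integral>\<^sup>+ x. ennreal (?f1 x powr p) \<partial>lebesgue)"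
      unfolding H_def using exps by (intro maximal_function_strong_type) auto
    also have "(\<integral>\<^sup>+ x. ennreal (?f1 x powr p) \<partial>lebesgue) =
        (\<integral>\<^sup>+ x \<in> cube (\<chi> i. a $ i - l) (3 * l). ennreal (\<bar>f x\<bar> powr p) \<partial>lebesgue)"
      by (intro nn_integral_cong) (auto simp: indicator_def)
    also have "ennreal H * \<dots> \<le> ennreal H * ennreal (N powr p * (3 * l) powr lam)"
      using l by (intro mult_left_mono f) auto
    finally have M: "(\<integral>\<^sup>+ x. ennreal_powr (maximal_function (\<lambda>y. ennreal (?f1 y)) x) p \<partial>lebesgue)
        \<le> ennreal (H * (N powr p * (3 * l) powr lam))"
      using H by (simp add: ennreal_mult)
    \<comment> \<open>The pointwise bound is available where \<open>b x = g x\<close>: there the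
      Lipschitz estimate of \<open>g\<close> passes to \<open>b\<close> for almost every
      \<open>y\<close>.\<close>
    have "AE x in lebesgue. x \<in> cube a l \<longrightarrow> ennreal_powr (maximal_commutator b f x) q \<le>
        ennreal A + ennreal B * ennreal_powr (maximal_function (\<lambda>y. ennreal (?f1 y)) x) p"
      using bg
    proof eventually_elim
      case (elim x)
      have near: "AE y in lebesgue. \<bar>b x - b y\<bar> \<le> C * norm (x - y) powr \<beta>"
        using bg by eventually_elim (simp add: elim gC)
      show ?case
      proof
        assume x: "x \<in> cube a l"
        show "ennreal_powr (maximal_commutator b f x) q \<le>
            ennreal A + ennreal B * ennreal_powr (maximal_function (\<lambda>y. ennreal (?f1 y)) x) p"
          unfolding A_def B_def L_def n_def
          by (rule commutator_pointwise_bound[OF b fm x l near C N f])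
            (use exps(1,2) rel(1,2,4) in \<open>simp_all only: n_def\<close>)
      qed
    qed
    then have "(\<integral>\<^sup>+ x \<in> cube a l. ennreal_powr (maximal_commutator b f x) q \<partial>lebesgue) \<le>
        (\<integral>\<^sup>+ x. ennreal A * indicator (cube a l) x +
          ennreal B * ennreal_powr (maximal_function (\<lambda>y. ennreal (?f1 y)) x) p \<partial>lebesgue)"
      by (intro nn_integral_mono_AE) (auto elim!: eventually_mono simp: indicator_def)
    also have "\<dots> = ennreal A * ennreal (l ^ CARD('n)) +
        ennreal B * (\<integral>\<^sup>+ x. ennreal_powr (maximal_function (\<lambda>y. ennreal (?f1 y)) x) p \<partial>lebesgue)"
      using l by (simp add: nn_integral_add nn_integral_cmult nn_integral_cmult_indicator emeasure_cube)
    also have "\<dots> \<le> ennreal A * ennreal (l ^ CARD('n)) + ennreal B * ennreal (H * (N powr p * (3 * l) powr lam))"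
      by (intro add_left_mono mult_left_mono M) simp
    also have "\<dots> = ennreal (A * l ^ CARD('n) + B * (H * (N powr p * (3 * l) powr lam)))"
      using l B H by (simp add: A_def ennreal_mult[symmetric] flip: ennreal_plus)
    also have "A * l ^ CARD('n) = (2 * L) powr q * N powr q * l powr mu"
    proof -
      have "l ^ CARD('n) = l powr n" using l by (simp add: n_def powr_realpow)
      moreover have "A = (2 * L) powr q * N powr q * l powr ((\<beta> + (lam - n) / p) * q)"
        using L N by (simp add: A_def powr_mult powr_powr)
      ultimately show ?thesis using rel(3) by (simp add: mult.assoc powr_add[symmetric])
    qed
    also have "B * (H * (N powr p * (3 * l) powr lam)) = L powr q * 2 powr (q - p) * H * 3 powr mu * N powr q * l powr mu"
    proof -
      \<comment> \<open>The powers of \<open>3 * l\<close> coming from \<open>B\<close> and from the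
        \<open>L\<^sup>p\<close> integral add up to \<open>mu\<close>.\<close>
      have e: "lam / p * (q - p) + lam = mu"
        using exps(2) unfolding rel(5)[symmetric] by (simp add: right_diff_distrib)
      have "B = L powr q * (2 powr (q - p) * N powr (q - p) * (3 * l) powr (lam / p * (q - p)))"
        using N by (simp add: B_def powr_mult powr_powr)
      then have "B * (H * (N powr p * (3 * l) powr lam)) = L powr q * 2 powr (q - p) * H *
          (N powr (q - p) * N powr p) * ((3 * l) powr (lam / p * (q - p)) * (3 * l) powr lam)"
        by (simp only: mult_ac)
      also have "\<dots> = L powr q * 2 powr (q - p) * H * N powr q * (3 * l) powr mu"
        unfolding powr_add[symmetric] e by simp
      finally show ?thesis using l by (simp add: powr_mult mult_ac)
    qed
    also have "(2 * L) powr q * N powr q * l powr mu + L powr q * 2 powr (q - p) * H * 3 powr mu * N powr q * l powr mu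
        = K * N powr q * l powr mu"
      by (simp add: K_def algebra_simps)
    also have "K * N powr q = (K powr (1 / q) * N) powr q"
      using K N q by (simp add: powr_mult powr_powr)
    finally show ?thesis .
  qed
  show ?thesis
    unfolding morrey_bounded_def
  proof (intro exI ballI conjI)
    fix f :: "real ^ 'n \<Rightarrow> real" assume f: "f \<in> morrey_space p lam"
    then have fm: "f \<in> borel_measurable lebesgue" by (simp add: morrey_space_def)
    show "maximal_commutator b f \<in> borel_measurable lebesgue"
      by (rule borel_measurable_maximal_commutator[OF b fm])
    obtain N where N: "0 \<le> N" "morrey_norm p lam (\<lambda>x. ennreal \<bar>f x\<bar>) = ennreal N"
      using f by (cases "morrey_norm p lam (\<lambda>x. ennreal \<bar>f x\<bar>)") (auto simp: morrey_space_def)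
    then have "\<forall>a l. 0 < l \<longrightarrow> (\<integral>\<^sup>+ x \<in> cube a l. ennreal (\<bar>f x\<bar> powr p) \<partial>lebesgue) \<le> ennreal (N powr p * l powr lam)"
      using morrey_norm_le_iff[of p N lam "\<lambda>x. ennreal \<bar>f x\<bar>"] exps by simp
    then have "morrey_norm q mu (maximal_commutator b f) \<le> ennreal (K powr (1 / q) * N)"
      using main[OF fm N(1)] q N by (subst morrey_norm_le_iff) auto
    then show "morrey_norm q mu (maximal_commutator b f)
        \<le> ennreal (K powr (1 / q)) * morrey_norm p lam (\<lambda>x. ennreal \<bar>f x\<bar>)"
      using N by (simp add: ennreal_mult)
  qed
qed

section \<open>Bounded commutators give Lipschitz functions\<close>

definition cube_mean :: "(real ^ 'n \<Rightarrow> real) \<Rightarrow> real ^ 'n \<Rightarrow> real \<Rightarrow> real" where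
  "cube_mean b a l = (LINT x:cube a l|lebesgue. b x) / l ^ CARD('n)"

lemma locally_integrable_cube:
  "locally_integrable b \<Longrightarrow> set_integrable lebesgue (cube a l) b"
  by (simp add: locally_integrable_def compact_cube)

lemma borel_measurable_locally_integrable:
  fixes b :: "real ^ 'n \<Rightarrow> real"
  assumes "locally_integrable b" shows "b \<in> borel_measurable lebesgue"
proof (rule borel_measurable_LIMSEQ_real)
  show "(\<lambda>x. indicator (cball 0 (real k)) x * b x) \<in> borel_measurable lebesgue" for k
  proof -
    have "set_integrable lebesgue (cball 0 (real k)) b"
      using assms by (auto simp: locally_integrable_def)
    then show ?thesis
      unfolding set_integrable_def by (auto dest: borel_measurable_integrable)
  qed
  show "(\<lambda>k. indicator (cball 0 (real k)) x * b x) \<longlonglongrightarrow> b x" for x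
  proof (rule tendsto_eventually)
    obtain N :: nat where "norm x \<le> real N" using real_arch_simple by blast
    then show "\<forall>\<^sub>F k in sequentially. indicator (cball 0 (real k)) x * b x = b x"
      by (intro eventually_sequentiallyI[of N]) (auto simp: indicator_def)
  qed
qed

text \<open>The difference is the mean of \<open>b - c\<close>. The constant \<open>c\<close> is
  free because it will be the mean over a larger cube in one place and the value \<open>b x\<close>
  in another.\<close>

lemma cube_mean_diff_le:
  fixes b :: "real ^ 'n \<Rightarrow> real"
  assumes "locally_integrable b" "0 < l"
  shows "ennreal (\<bar>cube_mean b a l - c\<bar> * l ^ CARD('n)) \<le> (\<integral>\<^sup>+ x \<in> cube a l. ennreal \<bar>b x - c\<bar> \<partial>lebesgue)"
proof -
  have b: "set_integrable lebesgue (cube a l) b" by (rule locally_integrable_cube[OF assms(1)])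
  have c: "set_integrable lebesgue (cube a l) (\<lambda>x. c)"
    unfolding set_integrable_def using assms(2)
    by (intro integrable_scaleR_left integrable_real_indicator) (auto simp: emeasure_cube)
  have ce: "(LINT x:cube a l|lebesgue. c) = c * l ^ CARD('n)"
    using assms(2) by (simp add: set_lebesgue_integral_def measure_cube)
  have d: "set_integrable lebesgue (cube a l) (\<lambda>x. b x - c)"
    by (rule set_integral_diff(1)[OF b c])
  have "(LINT x:cube a l|lebesgue. b x - c) = (LINT x:cube a l|lebesgue. b x) - c * l ^ CARD('n)"
    using set_integral_diff(2)[OF b c] ce by simp
  also have "\<dots> = (cube_mean b a l - c) * l ^ CARD('n)"
    using assms(2) by (simp add: cube_mean_def algebra_simps)
  finally have "\<bar>cube_mean b a l - c\<bar> * l ^ CARD('n) = norm (LINT x:cube a l|lebesgue. b x - c)"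
    using assms(2) by (simp add: abs_mult)
  also have "ennreal \<dots> \<le> (\<integral>\<^sup>+ x. norm (indicator (cube a l) x *\<^sub>R (b x - c)) \<partial>lebesgue)"
    using d unfolding set_integrable_def set_lebesgue_integral_def by (rule integral_norm_bound_ennreal)
  also have "\<dots> = (\<integral>\<^sup>+ x \<in> cube a l. ennreal \<bar>b x - c\<bar> \<partial>lebesgue)"
    by (intro nn_integral_cong) (auto simp: indicator_def)
  finally show ?thesis .
qed

text \<open>Splitting each cube into \<open>2\<^sup>n\<close> halves repeatedly improves the bound to 0.\<close>

lemma AE_zero_of_small_cube_integrals:
  fixes h :: "real ^ 'n \<Rightarrow> ennreal"
  assumes [measurable]: "h \<in> borel_measurable lebesgue" and "0 < \<beta>"
    and small: "\<And>a l. 0 < l \<Longrightarrow> (\<integral>\<^sup>+ x \<in> cube a l. h x \<partial>lebesgue) \<le> ennreal (E * l powr \<beta> * l ^ CARD('n))"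
  shows "AE x in lebesgue. h x = 0"
proof -
  \<comment> \<open>The volumes of the halves add up to that of the cube, while the factor
    \<open>l powr \<beta>\<close> shrinks, so each round of splitting gains
    \<open>2 powr - \<beta>\<close>.\<close>
  have halving: "(\<integral>\<^sup>+ x \<in> cube a l. h x \<partial>lebesgue) \<le> ennreal (E * (l / 2 ^ k) powr \<beta> * l ^ CARD('n))"
    if "0 < l" for a l and k :: nat
    using that
  proof (induction k arbitrary: a l)
    case 0 then show ?case using small by simp
  next
    case (Suc k)
    \<comment> \<open>A subcube is indexed by the set \<open>S\<close> of coordinates in which it
      takes the upper half.\<close>
    let ?a = "\<lambda>S. \<chi> i. a $ i + (if i \<in> S then l / 2 else 0)"
    have "(\<integral>\<^sup>+ x \<in> cube a l. h x \<partial>lebesgue) \<le>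
        (\<integral>\<^sup>+ x. (\<Sum>S\<in>UNIV. h x * indicator (cube (?a S) (l / 2)) x) \<partial>lebesgue)"
    proof (rule nn_integral_mono)
      fix x
      show "h x * indicator (cube a l) x \<le> (\<Sum>S\<in>UNIV. h x * indicator (cube (?a S) (l / 2)) x)"
      proof (cases "x \<in> cube a l")
        case True
        let ?S = "{i. a $ i + l / 2 < x $ i}"
        have "x \<in> cube (?a ?S) (l / 2)"
          using True by (auto simp: mem_cube) (smt (verit) field_sum_of_halves)+
        then have "h x * indicator (cube a l) x \<le> h x * indicator (cube (?a ?S) (l / 2)) x"
          using True by simp
        also have "\<dots> \<le> (\<Sum>S\<in>UNIV. h x * indicator (cube (?a S) (l / 2)) x)"
          by (rule member_le_sum) auto
        finally show ?thesis .
      qed simp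
    qed
    also have "\<dots> = (\<Sum>S\<in>UNIV. (\<integral>\<^sup>+ x \<in> cube (?a S) (l / 2). h x \<partial>lebesgue))"
      by (rule nn_integral_sum) measurable
    also have "\<dots> \<le> (\<Sum>S\<in>(UNIV :: 'n set set). ennreal (E * (l / 2 / 2 ^ k) powr \<beta> * (l / 2) ^ CARD('n)))"
      using Suc.prems by (intro sum_mono Suc.IH) simp
    also have "\<dots> = ennreal (E * (l / 2 ^ Suc k) powr \<beta> * l ^ CARD('n))"
    proof -
      have "card (UNIV :: 'n set set) = 2 ^ CARD('n)"
        using card_Pow[of "UNIV :: 'n set"] by simp
      then show ?thesis
        by (simp add: power_divide ennreal_of_nat_eq_real_of_nat ennreal_mult'[symmetric] mult_ac)
    qed
    finally show ?case .
  qed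
  have zero: "(\<integral>\<^sup>+ x \<in> cube a l. h x \<partial>lebesgue) = 0" if "0 < l" for a l
  proof -
    have "(\<lambda>k. l / 2 ^ k) \<longlonglongrightarrow> 0"
      using tendsto_mult_right_zero[OF LIMSEQ_power_zero[of "1 / 2 :: real"], of l]
      by (simp add: power_divide)
    then have "(\<lambda>k. (l / 2 ^ k) powr \<beta>) \<longlonglongrightarrow> 0"
      using that \<open>0 < \<beta>\<close> by (intro tendsto_zero_powrI[OF _ tendsto_const]) auto
    then have "(\<lambda>k. E * (l / 2 ^ k) powr \<beta> * l ^ CARD('n)) \<longlonglongrightarrow> 0"
      by (intro tendsto_mult_left_zero tendsto_mult_right_zero)
    then have "(\<lambda>k. ennreal (E * (l / 2 ^ k) powr \<beta> * l ^ CARD('n))) \<longlonglongrightarrow> ennreal 0"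
      by (rule tendsto_ennrealI)
    then have "(\<integral>\<^sup>+ x \<in> cube a l. h x \<partial>lebesgue) \<le> ennreal 0"
      by (rule tendsto_lowerbound) (use halving[OF that] in auto)
    then show ?thesis by simp
  qed
  \<comment> \<open>Countably many cubes centred at the origin exhaust the space;
    \<open>Suc k\<close> keeps the side positive at \<open>k = 0\<close>.\<close>
  define B :: "nat \<Rightarrow> (real ^ 'n) set" where "B k = cube (\<chi> i. - real (Suc k)) (2 * real (Suc k))" for k
  have "AE x in lebesgue. \<forall>k. x \<in> B k \<longrightarrow> h x = 0"
    unfolding AE_all_countable
  proof
    fix k
    have "(\<integral>\<^sup>+ x \<in> B k. h x \<partial>lebesgue) = 0" unfolding B_def by (rule zero) simp
    moreover have "(\<lambda>x. h x * indicator (B k) x) \<in> borel_measurable lebesgue" unfolding B_def by measurable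
    ultimately have "AE x in lebesgue. h x * indicator (B k) x = 0"
      by (simp add: nn_integral_0_iff_AE)
    then show "AE x in lebesgue. x \<in> B k \<longrightarrow> h x = 0" by (auto elim!: eventually_mono)
  qed
  then show ?thesis
  proof eventually_elim
    case (elim x)
    obtain k :: nat where k: "norm x \<le> real k" using real_arch_simple by blast
    have "x \<in> B k"
    proof -
      have "\<bar>x $ i\<bar> \<le> real k" for i using component_le_norm_cart[of x i] k by linarith
      then show ?thesis by (auto simp: B_def mem_cube abs_le_iff) (smt (verit))+
    qed
    then show ?case using elim by blast
  qed
qed

lemma holder_continuous_on:
  fixes g :: "'a::real_normed_vector \<Rightarrow> real"
  assumes "0 < \<beta>" "\<And>x y. \<bar>g x - g y\<bar> \<le> C * norm (x - y) powr \<beta>"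
  shows "continuous_on UNIV g"
proof -
  have "isCont g x" for x
  proof -
    have "((\<lambda>y. norm (y - x)) \<longlongrightarrow> 0) (at x)"
      by (intro tendsto_norm_zero LIM_zero tendsto_ident_at)
    then have "((\<lambda>y. norm (y - x) powr \<beta>) \<longlongrightarrow> 0) (at x)"
      using assms(1) by (intro tendsto_zero_powrI[OF _ tendsto_const]) auto
    then have "((\<lambda>y. C * norm (y - x) powr \<beta>) \<longlongrightarrow> 0) (at x)"
      by (rule tendsto_mult_right_zero)
    then have "((\<lambda>y. g y - g x) \<longlongrightarrow> 0) (at x)"
      by (rule Lim_null_comparison[rotated]) (use assms(2) in auto)
    then show ?thesis by (simp add: isCont_def LIM_zero_iff)
  qed
  then show ?thesis by (simp add: continuous_on_eq_continuous_at)
qed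

text \<open>That \<open>b\<close> agrees with the limit \<open>g\<close> of its means comes from
  \<open>AE_zero_of_small_cube_integrals\<close>, so Lebesgue's differentiation theorem does not
  enter.\<close>

theorem campanato_imp_lipschitz:
  fixes b :: "real ^ 'n \<Rightarrow> real"
  assumes b: "locally_integrable b" and \<beta>: "0 < \<beta>" and K: "0 \<le> K"
    and osc: "\<And>a l. 0 < l \<Longrightarrow>
      (\<integral>\<^sup>+ x \<in> cube a l. ennreal \<bar>b x - cube_mean b a l\<bar> \<partial>lebesgue) \<le> ennreal (K * l powr \<beta> * l ^ CARD('n))"
  shows "b \<in> lipschitz_space \<beta>"
proof -
  let ?m = "cube_mean b"
  have [measurable]: "b \<in> borel_measurable lebesgue" by (rule borel_measurable_locally_integrable[OF b])
  define D where "D = 2 ^ CARD('n) * K"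
  have D: "0 \<le> D" using K by (simp add: D_def)
  \<comment> \<open>The oscillation over the large cube controls that over the subcube; the ratio of
    the volumes is at most \<open>2 ^ CARD('n)\<close>, the factor in \<open>D\<close>.\<close>
  have step: "\<bar>?m a' l' - ?m a l\<bar> \<le> D * l powr \<beta>"
    if "0 < l" "l / 2 \<le> l'" "cube a' l' \<subseteq> cube a l" for a a' l l'
  proof -
    have l': "0 < l'" using that by simp
    have "ennreal (\<bar>?m a' l' - ?m a l\<bar> * l' ^ CARD('n)) \<le>
        (\<integral>\<^sup>+ x \<in> cube a' l'. ennreal \<bar>b x - ?m a l\<bar> \<partial>lebesgue)"
      by (rule cube_mean_diff_le[OF b l'])
    also have "\<dots> \<le> (\<integral>\<^sup>+ x \<in> cube a l. ennreal \<bar>b x - ?m a l\<bar> \<partial>lebesgue)"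
      using that(3) by (intro nn_integral_mono) (auto simp: indicator_def)
    also have "\<dots> \<le> ennreal (K * l powr \<beta> * l ^ CARD('n))" by (rule osc[OF that(1)])
    also have "\<dots> \<le> ennreal (K * l powr \<beta> * (2 * l') ^ CARD('n))"
      using that K by (intro ennreal_leI mult_left_mono power_mono) auto
    finally have "\<bar>?m a' l' - ?m a l\<bar> * l' ^ CARD('n) \<le> K * l powr \<beta> * (2 * l') ^ CARD('n)"
      using K l' by (subst (asm) ennreal_le_iff) auto
    also have "\<dots> = D * l powr \<beta> * l' ^ CARD('n)" by (simp add: D_def power_mult_distrib)
    finally show ?thesis using l' by simp
  qed
  \<comment> \<open>The sum of the geometric series with first term \<open>D\<close> and ratio
    \<open>2 powr - \<beta>\<close>; the identity \<open>C * 2 powr - \<beta> + D = C\<close> closes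
    the induction in \<open>tele\<close>.\<close>
  define C where "C = D / (1 - 2 powr - \<beta>)"
  have half: "(2::real) powr - \<beta> < 1" using powr_less_mono[of "- \<beta>" 0 2] \<beta> by simp
  have C: "D \<le> C" "C * 2 powr - \<beta> + D = C" "0 \<le> C"
  proof -
    have "C * (1 - 2 powr - \<beta>) = D" using half \<beta> by (simp add: C_def)
    then show eq: "C * 2 powr - \<beta> + D = C" by (simp add: right_diff_distrib)
    show "0 \<le> C" using half D by (simp add: C_def)
    then have "0 \<le> C * 2 powr - \<beta>" by simp
    then show "D \<le> C" using eq by linarith
  qed
  have tele: "\<bar>?m a s - ?m a l\<bar> \<le> C * l powr \<beta>"
    if "0 < l" "l / 2 ^ k \<le> s" "s \<le> l" for a s l and k :: nat
    using that
  proof (induction k arbitrary: l)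
    case 0
    then show ?case using C by simp
  next
    case (Suc k)
    show ?case
    proof (cases "l / 2 \<le> s")
      case True
      have "\<bar>?m a s - ?m a l\<bar> \<le> D * l powr \<beta>"
        using Suc.prems True by (intro step cube_subset) auto
      also have "\<dots> \<le> C * l powr \<beta>" by (intro mult_right_mono C) simp
      finally show ?thesis .
    next
      case False
      have "\<bar>?m a s - ?m a (l / 2)\<bar> \<le> C * (l / 2) powr \<beta>"
        using Suc.prems False by (intro Suc.IH) (auto simp: field_simps)
      moreover have "\<bar>?m a (l / 2) - ?m a l\<bar> \<le> D * l powr \<beta>"
        using Suc.prems by (intro step cube_subset) auto
      ultimately have "\<bar>?m a s - ?m a l\<bar> \<le> C * (l / 2) powr \<beta> + D * l powr \<beta>" by linarith
      also have "\<dots> = (C * 2 powr - \<beta> + D) * l powr \<beta>"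
        using Suc.prems by (simp add: powr_divide powr_minus field_simps)
      finally show ?thesis by (simp add: C(2))
    qed
  qed
  have near: "\<bar>?m a s - ?m a l\<bar> \<le> C * l powr \<beta>" if sl: "0 < s" "s \<le> l" for a s l
  proof -
    have l: "0 < l" using sl by simp
    obtain k where "(1 / 2) ^ k < s / l" using real_arch_pow_inv[of "s / l" "1 / 2"] sl l by auto
    then show ?thesis using sl l by (intro tele[of l k]) (auto simp: field_simps power_divide)
  qed
  define r where "r k = 1 / real (Suc k)" for k
  have r: "r \<longlonglongrightarrow> 0" unfolding r_def by (rule LIMSEQ_Suc[OF lim_1_over_n])
  have rpos: "0 < r k" for k by (simp add: r_def)
  have conv: "convergent (\<lambda>k. ?m a (r k))" for a
  proof (rule Cauchy_convergent, unfold Cauchy_altdef2, safe)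
    fix e :: real assume "0 < e"
    have "(\<lambda>k. C * r k powr \<beta>) \<longlonglongrightarrow> 0"
      using r \<beta> rpos by (intro tendsto_mult_right_zero tendsto_zero_powrI[OF _ tendsto_const]) (auto intro!: always_eventually less_imp_le)
    then obtain N where N: "C * r N powr \<beta> < e"
      using \<open>0 < e\<close> by (metis (no_types, lifting) order_tendstoD(2) eventually_sequentially order_refl)
    show "\<exists>N. \<forall>k\<ge>N. dist (?m a (r k)) (?m a (r N)) < e"
    proof (intro exI allI impI)
      fix k assume "N \<le> k"
      then have "r k \<le> r N" by (simp add: r_def field_simps)
      then have "dist (?m a (r k)) (?m a (r N)) \<le> C * r N powr \<beta>"
        using near[OF rpos] by (simp add: dist_real_def)
      then show "dist (?m a (r k)) (?m a (r N)) < e" using N by simp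
    qed
  qed
  define g where "g a = lim (\<lambda>k. ?m a (r k))" for a
  have gm: "\<bar>?m a l - g a\<bar> \<le> C * l powr \<beta>" if "0 < l" for a l
  proof -
    have "(\<lambda>k. ?m a (r k)) \<longlonglongrightarrow> g a" using conv by (simp add: g_def convergent_LIMSEQ_iff)
    then have "(\<lambda>k. \<bar>?m a l - ?m a (r k)\<bar>) \<longlonglongrightarrow> \<bar>?m a l - g a\<bar>" by (intro tendsto_intros)
    moreover have "\<forall>\<^sub>F k in sequentially. \<bar>?m a l - ?m a (r k)\<bar> \<le> C * l powr \<beta>"
      using order_tendstoD(2)[OF r that]
      by eventually_elim (use near[OF rpos] in \<open>simp add: abs_minus_commute\<close>)
    ultimately show ?thesis by (rule tendsto_upperbound) simp
  qed
  \<comment> \<open>\<open>2 * C\<close> pays for replacing \<open>g\<close> by means at both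
    points, \<open>2 * D * 2 powr \<beta>\<close> for comparing these means with the one over a
    common cube of doubled side.\<close>
  define H where "H = 2 * C + 2 * D * 2 powr \<beta>"
  have H: "0 \<le> H" using C D by (simp add: H_def)
  have holder: "\<bar>g x - g y\<bar> \<le> H * norm (x - y) powr \<beta>" for x y
  proof (cases "x = y")
    case False
    define l where "l = norm (x - y)"
    have l: "0 < l" using False by (simp add: l_def)
    \<comment> \<open>The coordinatewise minimum is the corner of a cube of side
      \<open>2 * l\<close> containing both \<open>cube x l\<close> and
      \<open>cube y l\<close>.\<close>
    define c where "c = (\<chi> i. min (x $ i) (y $ i))"
    have xy: "\<bar>x $ i - y $ i\<bar> \<le> l" for i
      unfolding l_def using component_le_norm_cart[of "x - y" i] by simp
    have sub: "cube x l \<subseteq> cube c (2 * l)" "cube y l \<subseteq> cube c (2 * l)"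
      using xy by (intro cube_subset; simp add: c_def min_def abs_le_iff; smt (verit))+
    have "\<bar>?m x l - ?m c (2 * l)\<bar> \<le> D * (2 * l) powr \<beta>" "\<bar>?m y l - ?m c (2 * l)\<bar> \<le> D * (2 * l) powr \<beta>"
      using l sub by (auto intro!: step)
    then have "\<bar>g x - g y\<bar> \<le> 2 * (C * l powr \<beta>) + 2 * (D * (2 * l) powr \<beta>)"
      using gm[OF l, of x] gm[OF l, of y] by linarith
    also have "\<dots> = H * l powr \<beta>" using l by (simp add: H_def powr_mult algebra_simps)
    finally show ?thesis by (simp add: l_def)
  qed simp
  have "g \<in> borel_measurable borel"
    using holder_continuous_on[OF \<beta> holder] by (rule borel_measurable_continuous_onI)
  then have [measurable]: "g \<in> borel_measurable lebesgue"
    by (intro measurable_completion) simp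
  define E where "E = K + C + H * real CARD('n) powr \<beta>"
  have "AE x in lebesgue. ennreal \<bar>b x - g x\<bar> = 0"
  proof (rule AE_zero_of_small_cube_integrals[OF _ \<beta>])
    show "(\<lambda>x. ennreal \<bar>b x - g x\<bar>) \<in> borel_measurable lebesgue" by measurable
    fix a :: "real ^ 'n" and l :: real assume l: "0 < l"
    \<comment> \<open>A bound for the distance from the mean over \<open>cube a l\<close> to
      \<open>g x\<close>, by way of \<open>g a\<close>.\<close>
    define F where "F = (C + H * real CARD('n) powr \<beta>) * l powr \<beta>"
    have F: "0 \<le> F" using C H by (simp add: F_def)
    have pw: "\<bar>b x - g x\<bar> \<le> \<bar>b x - ?m a l\<bar> + F" if "x \<in> cube a l" for x
    proof -
      have "\<bar>g a - g x\<bar> \<le> H * norm (a - x) powr \<beta>" by (rule holder)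
      also have "\<dots> \<le> H * (real CARD('n) * l) powr \<beta>"
        using l H \<beta> that by (intro mult_left_mono powr_mono2 cube_diameter) (auto intro: corner_in_cube)
      also have "\<dots> = H * real CARD('n) powr \<beta> * l powr \<beta>" using l by (simp add: powr_mult)
      finally have "\<bar>g a - g x\<bar> \<le> H * real CARD('n) powr \<beta> * l powr \<beta>" .
      then show ?thesis using gm[OF l, of a] unfolding F_def distrib_right by linarith
    qed
    have "(\<integral>\<^sup>+ x \<in> cube a l. ennreal \<bar>b x - g x\<bar> \<partial>lebesgue) \<le>
        (\<integral>\<^sup>+ x. ennreal \<bar>b x - ?m a l\<bar> * indicator (cube a l) x + ennreal F * indicator (cube a l) x \<partial>lebesgue)"
    proof (rule nn_integral_mono)
      fix x
      show "ennreal \<bar>b x - g x\<bar> * indicator (cube a l) x \<le>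
          ennreal \<bar>b x - ?m a l\<bar> * indicator (cube a l) x + ennreal F * indicator (cube a l) x"
        using pw[of x] F by (auto simp: indicator_def simp flip: ennreal_plus)
    qed
    also have "\<dots> = (\<integral>\<^sup>+ x \<in> cube a l. ennreal \<bar>b x - ?m a l\<bar> \<partial>lebesgue) + ennreal F * ennreal (l ^ CARD('n))"
      using l by (simp add: nn_integral_add nn_integral_cmult_indicator emeasure_cube)
    also have "\<dots> \<le> ennreal (K * l powr \<beta> * l ^ CARD('n)) + ennreal F * ennreal (l ^ CARD('n))"
      by (intro add_right_mono osc l)
    also have "\<dots> = ennreal (K * l powr \<beta> * l ^ CARD('n) + F * l ^ CARD('n))"
      using K F l by (simp add: ennreal_mult[symmetric] flip: ennreal_plus)
    also have "K * l powr \<beta> * l ^ CARD('n) + F * l ^ CARD('n) = E * l powr \<beta> * l ^ CARD('n)"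
      by (simp add: E_def F_def algebra_simps)
    finally show "(\<integral>\<^sup>+ x \<in> cube a l. ennreal \<bar>b x - g x\<bar> \<partial>lebesgue) \<le> ennreal (E * l powr \<beta> * l ^ CARD('n))" .
  qed
  then have "AE x in lebesgue. b x = g x" by eventually_elim simp
  then show ?thesis unfolding lipschitz_space_def using holder by blast
qed

section \<open>Testing the commutator on indicators of cubes\<close>

lemma indicator_cube_morrey_norm_le:
  fixes a :: "real ^ 'n"
  defines "n \<equiv> real CARD('n)"
  assumes "0 < l" "0 < p" "0 \<le> lam" "lam \<le> n"
  shows "morrey_norm p lam (\<lambda>x. ennreal \<bar>indicator (cube a l) x\<bar>) \<le> ennreal (l powr ((n - lam) / p))"
proof (subst morrey_norm_le_iff; (intro allI impI)?)
  fix c :: "real ^ 'n" and s :: real assume s: "0 < s"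
  have vol: "emeasure lebesgue (cube x t) = ennreal (t powr n)" if "0 < t" for x :: "real ^ 'n" and t
    using that by (simp add: emeasure_cube n_def powr_realpow)
  have "(\<integral>\<^sup>+ x \<in> cube c s. ennreal_powr (ennreal \<bar>indicator (cube a l) x\<bar>) p \<partial>lebesgue) =
      (\<integral>\<^sup>+ x. indicator (cube c s \<inter> cube a l) x \<partial>lebesgue)"
    using assms by (intro nn_integral_cong) (auto simp: indicator_def)
  also have "\<dots> = emeasure lebesgue (cube c s \<inter> cube a l)"
    by (intro nn_integral_indicator) simp
  also have "\<dots> \<le> ennreal (l powr (n - lam) * s powr lam)"
  \<comment> \<open>The intersection has volume at most the smaller of \<open>s powr n\<close> and
    \<open>l powr n\<close>. Since \<open>lam\<close> lies between 0 and \<open>n\<close>, this is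
    at most \<open>l powr (n - lam) * s powr lam\<close>.\<close>
  proof (cases "s \<le> l")
    case True
    have "emeasure lebesgue (cube c s \<inter> cube a l) \<le> ennreal (s powr n)"
      unfolding vol[OF s, of c, symmetric] by (intro emeasure_mono) auto
    also have "s powr n = s powr (n - lam) * s powr lam" by (simp add: powr_add[symmetric])
    also have "ennreal \<dots> \<le> ennreal (l powr (n - lam) * s powr lam)"
      using True s assms by (intro ennreal_leI mult_right_mono powr_mono2) auto
    finally show ?thesis .
  next
    case False
    have "emeasure lebesgue (cube c s \<inter> cube a l) \<le> ennreal (l powr n)"
      unfolding vol[OF assms(2), of a, symmetric] by (intro emeasure_mono) auto
    also have "l powr n = l powr (n - lam) * l powr lam" by (simp add: powr_add[symmetric])
    also have "ennreal \<dots> \<le> ennreal (l powr (n - lam) * s powr lam)"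
      using False assms by (intro ennreal_leI mult_left_mono powr_mono2) auto
    finally show ?thesis .
  qed
  also have "l powr (n - lam) = (l powr ((n - lam) / p)) powr p" using assms by (simp add: powr_powr)
  finally show "(\<integral>\<^sup>+ x \<in> cube c s. ennreal_powr (ennreal \<bar>indicator (cube a l) x\<bar>) p \<partial>lebesgue)
      \<le> ennreal ((l powr ((n - lam) / p)) powr p * s powr lam)" .
qed (use assms in auto)

lemma indicator_cube_morrey_space:
  fixes a :: "real ^ 'n"
  assumes "0 < l" "0 < p" "0 \<le> lam" "lam \<le> real CARD('n)"
  shows "indicator (cube a l) \<in> morrey_space p lam"
  unfolding morrey_space_def
proof (intro CollectI conjI allI impI)
  show "(indicator (cube a l) :: _ \<Rightarrow> real) \<in> borel_measurable lebesgue" by measurable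
  show "morrey_norm p lam (\<lambda>x. ennreal \<bar>indicator (cube a l) x\<bar>) < \<infinity>"
    using indicator_cube_morrey_norm_le[OF assms, of a] by (rule order_le_less_trans) simp
  fix K :: "(real ^ 'n) set" assume "compact K"
  then have "K \<inter> cube a l \<in> lmeasurable" by (intro lmeasurable_compact compact_Int compact_cube)
  then have "integrable lebesgue (indicator (K \<inter> cube a l) :: _ \<Rightarrow> real)"
    by (intro integrable_real_indicator) (auto simp: fmeasurable_def)
  moreover have "indicator K x *\<^sub>R \<bar>indicator (cube a l) x\<bar> powr p = indicator (K \<inter> cube a l) x" for x
    using assms by (auto simp: indicator_def)
  ultimately show "(\<lambda>x. \<bar>indicator (cube a l) x\<bar> powr p) absolutely_integrable_on K"
    by (simp add: set_integrable_def)
qed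

text \<open>On \<open>cube a l\<close> the commutator of its indicator dominates the average of
  \<open>\<bar>b x - b y\<bar>\<close> over \<open>y\<close>, hence the distance of
  \<open>b x\<close> from the mean. The Morrey bound, turned into an \<open>L\<^sup>1\<close> bound,
  then controls the mean oscillation.\<close>

theorem morrey_bounded_imp_lipschitz:
  fixes b :: "real ^ 'n \<Rightarrow> real"
  defines "n \<equiv> real CARD('n)"
  assumes b: "locally_integrable b"
    and bounded: "morrey_bounded (maximal_commutator b) p lam q mu"
    and exps: "0 < \<beta>" "0 < p" "1 \<le> q" "0 \<le> lam" "lam \<le> n" "1 / q = 1 / p - \<beta> / n" "lam / p = mu / q"
  shows "b \<in> lipschitz_space \<beta>"
proof -
  have [measurable]: "b \<in> borel_measurable lebesgue" by (rule borel_measurable_locally_integrable[OF b])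
  have n: "0 < n" by (simp add: n_def)
  obtain C0 where C0: "\<And>f. f \<in> morrey_space p lam \<Longrightarrow> maximal_commutator b f \<in> borel_measurable lebesgue \<and>
      morrey_norm q mu (maximal_commutator b f) \<le> ennreal C0 * morrey_norm p lam (\<lambda>x. ennreal \<bar>f x\<bar>)"
    using bounded unfolding morrey_bounded_def by blast
  \<comment> \<open>\<open>C0\<close> may be negative, in which case \<open>ennreal C0\<close> is
    0.\<close>
  define C where "C = max 0 C0"
  have C: "0 \<le> C" "ennreal C0 = ennreal C" by (auto simp: C_def max_def ennreal_neg)
  show ?thesis
  proof (rule campanato_imp_lipschitz[OF b exps(1), of "2 * C"])
    fix a :: "real ^ 'n" and l :: real assume l: "0 < l"
    let ?Mb = "maximal_commutator b (indicator (cube a l))"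
    define N where "N = C * l powr ((n - lam) / p)"
    have N: "0 \<le> N" using C by (simp add: N_def)
    have f: "indicator (cube a l) \<in> morrey_space p lam"
      using l exps unfolding n_def by (intro indicator_cube_morrey_space)
    have Mb [measurable]: "?Mb \<in> borel_measurable lebesgue" using C0[OF f] by blast
    have "morrey_norm q mu ?Mb \<le> ennreal C * morrey_norm p lam (\<lambda>x. ennreal \<bar>indicator (cube a l) x\<bar>)"
      using C0[OF f] C(2) by simp
    also have "\<dots> \<le> ennreal C * ennreal (l powr ((n - lam) / p))"
      using l exps unfolding n_def by (intro mult_left_mono indicator_cube_morrey_norm_le) auto
    also have "\<dots> = ennreal N" using C by (simp add: N_def ennreal_mult)
    finally have "(\<integral>\<^sup>+ x \<in> cube a l. ennreal_powr (?Mb x) q \<partial>lebesgue) \<le> ennreal (N powr q * l powr mu)"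
      using morrey_norm_le_iff[of q N mu ?Mb] N l exps by simp
    also have "N powr q * l powr mu = (N * l powr ((mu - n) / q)) powr q * l ^ CARD('n)"
    proof -
      have "l ^ CARD('n) = l powr n" using l by (simp add: n_def powr_realpow)
      then show ?thesis using N l exps by (simp add: powr_mult powr_powr mult.assoc powr_add[symmetric])
    qed
    \<comment> \<open>In the sum of the exponents \<open>lam / p\<close> cancels
      \<open>mu / q\<close>, and \<open>n / p - n / q\<close> is \<open>\<beta>\<close>.\<close>
    also have "N * l powr ((mu - n) / q) = C * l powr \<beta>"
    proof -
      have "n / q = n / p - \<beta>" using arg_cong[OF exps(6), of "\<lambda>t. n * t"] n by (simp add: right_diff_distrib)
      then have "(n - lam) / p + (mu - n) / q = \<beta>" using exps(7) by (simp add: diff_divide_distrib)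
      then show ?thesis by (simp add: N_def mult.assoc powr_add[symmetric])
    qed
    finally have "(\<integral>\<^sup>+ x \<in> cube a l. ?Mb x \<partial>lebesgue) \<le> ennreal (2 * (C * l powr \<beta>) * l ^ CARD('n))"
      using exps l C by (intro cube_integral_le_of_powr) auto
    moreover have "(\<integral>\<^sup>+ x \<in> cube a l. ennreal \<bar>b x - cube_mean b a l\<bar> \<partial>lebesgue) \<le> (\<integral>\<^sup>+ x \<in> cube a l. ?Mb x \<partial>lebesgue)"
    proof (rule nn_integral_mono)
      fix x
      have "ennreal \<bar>b x - cube_mean b a l\<bar> \<le> ?Mb x" if x: "x \<in> cube a l"
      proof -
        have "ennreal \<bar>b x - cube_mean b a l\<bar> = ennreal (\<bar>cube_mean b a l - b x\<bar> * l ^ CARD('n)) / ennreal (l ^ CARD('n))"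
          using l by (simp add: divide_ennreal abs_minus_commute)
        also have "\<dots> \<le> (\<integral>\<^sup>+ y \<in> cube a l. ennreal \<bar>b y - b x\<bar> \<partial>lebesgue) / ennreal (l ^ CARD('n))"
          by (intro divide_right_mono_ennreal cube_mean_diff_le[OF b l])
        also have "(\<integral>\<^sup>+ y \<in> cube a l. ennreal \<bar>b y - b x\<bar> \<partial>lebesgue) =
            (\<integral>\<^sup>+ y \<in> cube a l. ennreal (\<bar>b x - b y\<bar> * \<bar>indicator (cube a l) y\<bar>) \<partial>lebesgue)"
          by (intro nn_integral_cong) (auto simp: indicator_def abs_minus_commute)
        also have "ennreal (l ^ CARD('n)) = emeasure lebesgue (cube a l)" using l by (simp add: emeasure_cube)
        also have "(\<integral>\<^sup>+ y \<in> cube a l. ennreal (\<bar>b x - b y\<bar> * \<bar>indicator (cube a l) y\<bar>) \<partial>lebesgue) /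
            emeasure lebesgue (cube a l) \<le> ?Mb x"
          unfolding maximal_commutator_def using x l by (intro SUP_upper) (auto intro: cube_in_cubes)
        finally show ?thesis .
      qed
      then show "ennreal \<bar>b x - cube_mean b a l\<bar> * indicator (cube a l) x \<le> ?Mb x * indicator (cube a l) x"
        by (auto simp: indicator_def)
    qed
    ultimately show "(\<integral>\<^sup>+ x \<in> cube a l. ennreal \<bar>b x - cube_mean b a l\<bar> \<partial>lebesgue)
        \<le> ennreal (2 * C * l powr \<beta> * l ^ CARD('n))"
      by (simp add: mult.assoc)
  qed (use C in simp)
qed

theorem theorem1p3:
  fixes b :: "real ^ 'n \<Rightarrow> real" and \<beta> p q lam mu :: real
  assumes "locally_integrable b"
    and "0 < \<beta>" "\<beta> < 1"
    and "1 < p" "p < real CARD('n) / \<beta>"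
    and "0 < lam" "lam < real CARD('n) - \<beta> * p"
    and "1 / q = 1 / p - \<beta> / real CARD('n)"
    and "lam / p = mu / q"
  shows "b \<in> lipschitz_space \<beta> \<longleftrightarrow> morrey_bounded (maximal_commutator b) p lam q mu"
proof
  assume "b \<in> lipschitz_space \<beta>"
  then show "morrey_bounded (maximal_commutator b) p lam q mu"
    using assms by (intro lipschitz_imp_morrey_bounded borel_measurable_locally_integrable)
next
  have "p < q" by (rule exponent_relations(1)[OF _ assms(2,4-9)]) simp
  moreover have "lam \<le> real CARD('n)" using assms mult_pos_pos[of \<beta> p] by linarith
  moreover assume bounded: "morrey_bounded (maximal_commutator b) p lam q mu"
  ultimately show "b \<in> lipschitz_space \<beta>"
    using assms(4,6) by (intro morrey_bounded_imp_lipschitz[OF assms(1) bounded assms(2) _ _ _ _ assms(8,9)]) simp_all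
qed

end
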